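(* Let $n \geq 3$. A map $Z : \mathcal{T}_o^n \to \mathcal{K}_o^n$ is an $\mathrm{SL}(n)$ covariant Minkowski valuation if and only if there exist constants $a_1,a_2,b_1,b_2,c_1,c_2 \geq 0$ satisfying $a_1 \leq a_2$, $b_1 \leq b_2$, $a_2-a_1 \leq b_2$ and $b_2-b_1 \leq a_2$ such that $$ZT = c_1 M^+ T + c_2 M^- T + D_{a_1,a_2,b_1,b_2} T$$ for every $T \in \mathcal{T}_o^n$.
   Context: $\mathcal{K}_o^n$ denotes the set of convex bodies (compact convex sets) in $\mathbb{R}^n$ containing the origin $o$, and $\mathcal{T}_o^n$ the set of simplices (of any dimension $0\le d\le n$) in $\mathbb{R}^n$ having the origin as one of their vertices. $+$ denotes Minkowski addition. A map $Z:\mathcal{T}_o^n\to\mathcal{K}_o^n$ is a Minkowski valuation if $Z(K\cup L)+Z(K\cap L)=ZK+ZL$ whenever $K,L,K\cup L,K\cap L\in\mathcal{T}_o^n$; it is $\mathrm{SL}(n)$ covariant if $Z(\phi K)=\phi ZK$ for all $\phi\in\mathrm{SL}(n)$. The moment bodies are defined by $h_{M^+K}(x)=\int_K \max\{x\cdot y,0\}\,dy$, $h_{M^-K}(x)=\int_K \max\{-x\cdot y,0\}\,dy$ (Lebesgue measure on $\mathbb{R}^n$), $h$ denoting support functions. For $T=[o,v_1,\dots,v_d]$ with $o,v_1,\dots,v_d$ affinely independent and $2\le d\le n$, $D_{a_1,a_2,b_1,b_2}T = \mathrm{conv}\{a_2v_i-b_2v_j,\ a_2v_i-(a_2-a_1)v_j,\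 (b_2-b_1)v_i-b_2v_j : 1\le i,j\le d\}$; for $T=[o,v_1]$, $D_{a_1,a_2,b_1,b_2}T=[-b_1v_1,a_1v_1]$; and $D_{a_1,a_2,b_1,b_2}\{o\}=\{o\}$. Here $[\cdot]$ denotes convex hull. *)

theory Defs
  imports "HOL-Analysis.Analysis"
begin

definition minkowski_sum :: "'a::real_vector set \<Rightarrow> 'a set \<Rightarrow> 'a set" (infixl "\<oplus>\<^sub>M" 65)
  where "A \<oplus>\<^sub>M B = {x + y | x y. x \<in> A \<and> y \<in> B}"

definition convex_bodies_o :: "(real^'n) set set"
  where "convex_bodies_o = {K. compact K \<and> convex K \<and> 0 \<in> K}"

definition origin_simplices :: "(real^'n) set set"
  where "origin_simplices =
     {convex hull (insert 0 V) | V. finite V \<and> independent V}"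

definition minkowski_valuation_on ::
  "(real^'n) set set \<Rightarrow> ((real^'n) set \<Rightarrow> (real^'n) set) \<Rightarrow> bool"
  where "minkowski_valuation_on S Z \<longleftrightarrow>
    (\<forall>K L. K \<in> S \<longrightarrow> L \<in> S \<longrightarrow> K \<union> L \<in> S \<longrightarrow> K \<inter> L \<in> S \<longrightarrow>
       Z (K \<union> L) \<oplus>\<^sub>M Z (K \<inter> L) = Z K \<oplus>\<^sub>M Z L)"

definition SL_covariant_on ::
  "(real^'n) set set \<Rightarrow> ((real^'n) set \<Rightarrow> (real^'n) set) \<Rightarrow> bool"
  where "SL_covariant_on S Z \<longleftrightarrow>
    (\<forall>A :: real^'n^'n. det A = 1 \<longrightarrow>
       (\<forall>K \<in> S. Z ((\<lambda>x. A *v x) ` K) = (\<lambda>x. A *v x) ` Z K))"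

definition body_of_support :: "(real^'n \<Rightarrow> real) \<Rightarrow> (real^'n) set"
  where "body_of_support h = {z. \<forall>x. x \<bullet> z \<le> h x}"

definition moment_plus :: "(real^'n) set \<Rightarrow> (real^'n) set"
  where "moment_plus K = body_of_support (\<lambda>x. integral K (\<lambda>y. max (x \<bullet> y) 0))"

definition moment_minus :: "(real^'n) set \<Rightarrow> (real^'n) set"
  where "moment_minus K = body_of_support (\<lambda>x. integral K (\<lambda>y. max (- (x \<bullet> y)) 0))"

text \<open>The body D_{a1,a2,b1,b2} T for T = conv (insert 0 V), given via the vertex set V.\<close>
definition D_body :: "real \<Rightarrow> real \<Rightarrow> real \<Rightarrow> real \<Rightarrow> (real^'n) set \<Rightarrow> (real^'n) set"
  where "D_body a1 a2 b1 b2 V =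
    (if card V \<ge> 2 then
       convex hull ({a2 *\<^sub>R vi - b2 *\<^sub>R vj | vi vj. vi \<in> V \<and> vj \<in> V}
                  \<union> {a2 *\<^sub>R vi - (a2 - a1) *\<^sub>R vj | vi vj. vi \<in> V \<and> vj \<in> V}
                  \<union> {(b2 - b1) *\<^sub>R vi - b2 *\<^sub>R vj | vi vj. vi \<in> V \<and> vj \<in> V})
     else if card V = 1 then
       closed_segment (- b1 *\<^sub>R the_elem V) (a1 *\<^sub>R the_elem V)
     else {0})"

end

theory Submission
  imports Defs
begin

text \<open>Everything is expressed through support functions. For a simplex with vertex matrix \<open>A\<close>,
  \<open>SL(n)\<close> covariance makes \<open>h(Z T, x)\<close> a function of \<open>y = A x\<close> and \<open>s = det A\<close> only, and independent
  of \<open>s\<close> below full dimension. Cutting an edge at a point of relative position \<open>l\<close> turns the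
  valuation property into a functional equation relating \<open>y\<close> to the points in which \<open>y_i\<close> or
  \<open>y_j\<close> is replaced by \<open>w = (1 - l) y_i + l y_j\<close>. Two equal coordinates reduce the dimension, so
  below full dimension the functional is determined by its values on segments and triangles, which
  are the four parameters of \<open>D\<close>. In full dimension the difference to the \<open>D\<close> part solves the
  homogeneous equation; inserting 0 as a third value removes nonzero coordinates one by one, so it is
  determined at \<open>e_i\<close> and \<open>- e_i\<close>, where it is additive in \<open>s\<close> and bounded below, hence linear: these two
  numbers are the coefficients of the moment bodies. The inequalities between the parameters express
  convexity of the support function, and \<open>a1 \<le> a2\<close>, \<open>b1 \<le> b2\<close> need a third coordinate. Conversely, \<open>h(D T, x)\<close>
  depends only on the maximum and the minimum of \<open>x\<close> on the face of \<open>T\<close> opposite to the origin, and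
  these faces form a convex dissection whenever the simplices do.\<close>

section \<open>Support functions\<close>

text \<open>Minkowski addition has no subtraction, so the D part and the moment parts can be taken
  off \<open>Z\<close> only at the level of functions, and what remains need not be a support
  function. Uniqueness is therefore proved for real-valued functionals that are merely continuous
  and positively homogeneous; nonnegativity and subadditivity of the support functions of
  \<open>Z\<close> supply only signs, the lower bound behind linearity in \<open>s\<close>, and the
  inequalities between the parameters. The order of subtraction is forced. A cut of a
  full-dimensional simplex produces a common face of lower dimension, and additivity in
  \<open>s\<close> appears only once the functional vanishes on such faces, that is, after D has
  been removed. The determinant has to be carried along because \<open>SL(n)\<close> preserves
  volume. Below full dimension a row of the matrix is not a vertex and can absorb any change of
  volume or orientation; in full dimension there is no such row, and only even reorderings of the
  vertices are available.\<close>

definition support_fun :: "'a::euclidean_space set \<Rightarrow> 'a \<Rightarrow> real"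
  where "support_fun K x = Sup ((\<bullet>) x ` K)"

lemma support_fun_eqI:
  assumes "z \<in> K" "x \<bullet> z = c" "\<And>y. y \<in> K \<Longrightarrow> x \<bullet> y \<le> c"
  shows "support_fun K x = c"
  unfolding support_fun_def by (rule cSup_eq_maximum) (use assms in auto)

lemma support_fun_attained:
  assumes "compact K" "K \<noteq> {}"
  obtains z where "z \<in> K" "support_fun K x = x \<bullet> z" "\<And>y. y \<in> K \<Longrightarrow> x \<bullet> y \<le> x \<bullet> z"
proof -
  have "continuous_on K ((\<bullet>) x)" by (intro continuous_intros)
  from continuous_attains_sup[OF assms this] obtain z where "z \<in> K" "\<forall>y\<in>K. x \<bullet> y \<le> x \<bullet> z" by auto
  then show ?thesis using that support_fun_eqI[of z K x "x \<bullet> z"] by auto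
qed

lemma support_fun_upper:
  assumes "compact K" "z \<in> K"
  shows "x \<bullet> z \<le> support_fun K x"
  by (rule support_fun_attained[of K x]) (use assms in auto)

lemma support_fun_nonneg: "compact K \<Longrightarrow> 0 \<in> K \<Longrightarrow> 0 \<le> support_fun K x"
  using support_fun_upper[of K 0 x] by simp

lemma support_fun_sum:
  assumes "compact A" "compact B" "A \<noteq> {}" "B \<noteq> {}"
  shows "support_fun (A \<oplus>\<^sub>M B) x = support_fun A x + support_fun B x"
proof -
  obtain a where a: "a \<in> A" "support_fun A x = x \<bullet> a" "\<And>y. y \<in> A \<Longrightarrow> x \<bullet> y \<le> x \<bullet> a"
    using support_fun_attained assms by metis
  obtain b where b: "b \<in> B" "support_fun B x = x \<bullet> b" "\<And>y. y \<in> B \<Longrightarrow> x \<bullet> y \<le> x \<bullet> b"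
    using support_fun_attained assms by metis
  show ?thesis
    by (rule support_fun_eqI[of "a + b"])
       (use a(1,2) b(1,2) add_mono[OF a(3) b(3)] in \<open>auto simp: minkowski_sum_def inner_add_right\<close>)
qed

lemma support_fun_scale:
  assumes "compact A" "A \<noteq> {}" "c \<ge> 0"
  shows "support_fun ((*\<^sub>R) c ` A) x = c * support_fun A x"
proof -
  obtain a where a: "a \<in> A" "support_fun A x = x \<bullet> a" "\<And>y. y \<in> A \<Longrightarrow> x \<bullet> y \<le> x \<bullet> a"
    using support_fun_attained assms by metis
  show ?thesis
    by (rule support_fun_eqI[of "c *\<^sub>R a"])
       (use a(1,2) mult_left_mono[OF a(3) assms(3)] in auto)
qed

lemma support_fun_homogeneous:
  assumes "compact A" "A \<noteq> {}" "c \<ge> 0"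
  shows "support_fun A (c *\<^sub>R x) = c * support_fun A x"
proof -
  obtain a where a: "a \<in> A" "support_fun A x = x \<bullet> a" "\<And>y. y \<in> A \<Longrightarrow> x \<bullet> y \<le> x \<bullet> a"
    using support_fun_attained assms by metis
  show ?thesis
    by (rule support_fun_eqI[of a]) (use a(1,2) mult_left_mono[OF a(3) assms(3)] in auto)
qed

lemma support_fun_subadditive:
  assumes "compact A" "A \<noteq> {}"
  shows "support_fun A (x + y) \<le> support_fun A x + support_fun A y"
proof -
  obtain a where "a \<in> A" "support_fun A (x + y) = (x + y) \<bullet> a"
    using support_fun_attained assms by metis
  then show ?thesis
    using support_fun_upper[OF assms(1), of a x] support_fun_upper[OF assms(1), of a y]
    by (simp add: inner_add_left)
qed

lemma continuous_on_support_fun: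
  assumes "compact A" "A \<noteq> {}"
  shows "continuous_on UNIV (support_fun A)"
proof (rule convex_on_continuous[OF open_UNIV])
  show "convex_on UNIV (support_fun A)"
  proof (rule convex_onI)
    fix t :: real and x y :: 'a assume "0 < t" "t < 1"
    then show "support_fun A ((1 - t) *\<^sub>R x + t *\<^sub>R y)
        \<le> (1 - t) * support_fun A x + t * support_fun A y"
      using support_fun_subadditive[OF assms, of "(1 - t) *\<^sub>R x" "t *\<^sub>R y"]
      by (simp add: support_fun_homogeneous[OF assms])
  qed simp
qed

text \<open>A point of \<open>A\<close> outside \<open>B\<close> would be strictly separated from
  \<open>B\<close>; in the direction \<open>- a\<close> this contradicts the inequality. Applied
  both ways it gives \<open>support_fun_inject\<close>, the way back from functions to
  bodies.\<close>

lemma support_fun_subset_imp_subset: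
  fixes A B :: "'a::euclidean_space set"
  assumes "compact A" "compact B" "convex B" "B \<noteq> {}"
    and le: "\<And>x. support_fun A x \<le> support_fun B x"
  shows "A \<subseteq> B"
proof
  fix z assume z: "z \<in> A"
  show "z \<in> B"
  proof (rule ccontr)
    assume "z \<notin> B"
    then obtain a b where ab: "a \<bullet> z < b" "\<forall>x\<in>B. b < a \<bullet> x"
      using separating_hyperplane_closed_point[of B z] assms compact_imp_closed by blast
    obtain y where y: "y \<in> B" "support_fun B (- a) = - a \<bullet> y"
      using support_fun_attained assms by metis
    have "- a \<bullet> z \<le> - a \<bullet> y"
      using support_fun_upper[OF assms(1) z, of "- a"] le[of "- a"] y by simp
    with ab y show False by fastforce
  qed
qed

lemma support_fun_inject:
  fixes A B :: "'a::euclidean_space set"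
  assumes "compact A" "convex A" "A \<noteq> {}" "compact B" "convex B" "B \<noteq> {}"
    and "\<And>x. support_fun A x = support_fun B x"
  shows "A = B"
  using support_fun_subset_imp_subset[of A B] support_fun_subset_imp_subset[of B A] assms by auto

lemma support_fun_matrix_image:
  fixes Q :: "real^'n^'n"
  shows "support_fun ((*v) Q ` K) x = support_fun K (transpose Q *v x)"
  unfolding support_fun_def image_image by (simp add: dot_lmul_matrix)

lemma support_fun_convex_hull_finite:
  assumes "finite V" "V \<noteq> {}"
  shows "support_fun (convex hull V) x = Max ((\<bullet>) x ` V)"
proof -
  obtain v where v: "v \<in> V" "x \<bullet> v = Max ((\<bullet>) x ` V)"
    using Max_in[of "(\<bullet>) x ` V"] assms by fastforce
  have "convex hull V \<subseteq> {y. x \<bullet> y \<le> Max ((\<bullet>) x ` V)}"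
    by (rule hull_minimal) (use assms in \<open>auto simp: convex_halfspace_le\<close>)
  then show ?thesis
    by (intro support_fun_eqI[of v]) (use v hull_inc[of v V convex] in auto)
qed

lemma compact_minkowski_sum: "compact A \<Longrightarrow> compact B \<Longrightarrow> compact (A \<oplus>\<^sub>M B)"
  for A B :: "'a::real_normed_vector set"
  unfolding minkowski_sum_def by (rule compact_sums)

lemma convex_minkowski_sum: 
  assumes "convex A" "convex B" shows "convex (A \<oplus>\<^sub>M B)"
proof -
  have "A \<oplus>\<^sub>M B = (\<Union>x\<in>A. \<Union>y\<in>B. {x + y})" by (auto simp: minkowski_sum_def)
  then show ?thesis using convex_sums[OF assms] by simp
qed

lemma minkowski_sum_nonempty: "A \<noteq> {} \<Longrightarrow> B \<noteq> {} \<Longrightarrow> A \<oplus>\<^sub>M B \<noteq> {}"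
  by (auto simp: minkowski_sum_def)

text \<open>A segment is connected and is covered here by two closed sets that both meet it, so they
  meet each other on it.\<close>

lemma convex_union_meets:
  fixes A B :: "'a::euclidean_space set"
  assumes "closed A" "closed B" "convex (A \<union> B)" "a \<in> A" "b \<in> B"
  obtains c where "c \<in> A" "c \<in> B" "c \<in> closed_segment a b"
proof -
  have "closed_segment a b \<subseteq> A \<union> B"
    using assms by (intro closed_segment_subset) auto
  moreover have "connected (closed_segment a b)" by simp
  moreover have "A \<inter> closed_segment a b \<noteq> {}" "B \<inter> closed_segment a b \<noteq> {}"
    using assms ends_in_segment[of a b] by blast+
  ultimately have "A \<inter> B \<inter> closed_segment a b \<noteq> {}"
    using assms(1,2) unfolding connected_closed by blast
  then show ?thesis using that by auto
qed

lemma support_fun_Un: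
  fixes A B :: "'a::euclidean_space set"
  assumes "compact A" "compact B" "A \<noteq> {}" "B \<noteq> {}"
  shows "support_fun (A \<union> B) x = max (support_fun A x) (support_fun B x)"
proof -
  obtain a where a: "a \<in> A" "support_fun A x = x \<bullet> a" "\<And>y. y \<in> A \<Longrightarrow> x \<bullet> y \<le> x \<bullet> a"
    using support_fun_attained assms by metis
  obtain b where b: "b \<in> B" "support_fun B x = x \<bullet> b" "\<And>y. y \<in> B \<Longrightarrow> x \<bullet> y \<le> x \<bullet> b"
    using support_fun_attained assms by metis
  show ?thesis
  proof (rule support_fun_eqI)
    show "(if x \<bullet> a \<le> x \<bullet> b then b else a) \<in> A \<union> B" using a b by simp
    show "x \<bullet> y \<le> max (support_fun A x) (support_fun B x)" if "y \<in> A \<union> B" for y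
      using that a(2) b(2) a(3)[of y] b(3)[of y] by (auto simp: max_def)
  qed (simp add: a(2) b(2) max_def)
qed

text \<open>On the segment between a maximizer in \<open>A\<close> and a maximizer in
  \<open>B\<close> there is a common point \<open>c\<close>. Along that segment
  \<open>x \<bullet> c\<close> is at least the smaller of the two maxima, and as a point of both
  sets it cannot exceed either.\<close>

lemma support_fun_Int:
  fixes A B :: "'a::euclidean_space set"
  assumes "compact A" "compact B" "A \<noteq> {}" "B \<noteq> {}" "convex (A \<union> B)"
  shows "A \<inter> B \<noteq> {}" and "support_fun (A \<inter> B) x = min (support_fun A x) (support_fun B x)"
proof -
  obtain a where a: "a \<in> A" "support_fun A x = x \<bullet> a" "\<And>y. y \<in> A \<Longrightarrow> x \<bullet> y \<le> x \<bullet> a"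
    using support_fun_attained assms by metis
  obtain b where b: "b \<in> B" "support_fun B x = x \<bullet> b" "\<And>y. y \<in> B \<Longrightarrow> x \<bullet> y \<le> x \<bullet> b"
    using support_fun_attained assms by metis
  obtain c where c: "c \<in> A" "c \<in> B" "c \<in> closed_segment a b"
    using convex_union_meets[OF _ _ assms(5) a(1) b(1)] assms(1,2) compact_imp_closed by blast
  then show "A \<inter> B \<noteq> {}" by auto
  have "closed_segment a b \<subseteq> {y. min (x \<bullet> a) (x \<bullet> b) \<le> x \<bullet> y}"
    by (intro closed_segment_subset) (auto simp: convex_halfspace_ge)
  with c have "min (x \<bullet> a) (x \<bullet> b) \<le> x \<bullet> c" by auto
  with a(3)[OF c(1)] b(3)[OF c(2)]
  have "x \<bullet> c = min (x \<bullet> a) (x \<bullet> b)" by simp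
  then show "support_fun (A \<inter> B) x = min (support_fun A x) (support_fun B x)"
    by (intro support_fun_eqI[of c]) (use a(2,3) b(2,3) c in auto)
qed

section \<open>Moment bodies\<close>

lemma measure_swap_cbox:
  fixes a b :: "real^'n"
  shows "measure lebesgue ((\<lambda>x. \<chi> i. x $ Transposition.transpose m n i) ` cbox a b)
    = measure lebesgue (cbox a b)" (is "measure lebesgue (?f ` _) = _")
proof -
  have inv: "?f (?f x) = x" for x :: "real^'n" by (simp add: vec_eq_iff)
  have all: "(\<forall>i. P (Transposition.transpose m n i)) \<longleftrightarrow> (\<forall>i. P i)" for P :: "'n \<Rightarrow> bool"
    by (metis transpose_involutory)
  have ex: "(\<exists>i. P (Transposition.transpose m n i)) \<longleftrightarrow> (\<exists>i. P i)" for P :: "'n \<Rightarrow> bool"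
    by (metis transpose_involutory)
  have "?f ` cbox a b = cbox (?f a) (?f b)"
  proof (rule set_eqI)
    fix x
    have "x \<in> ?f ` cbox a b \<longleftrightarrow> ?f x \<in> cbox a b"
    proof
      assume "?f x \<in> cbox a b"
      then have "?f (?f x) \<in> ?f ` cbox a b" by (rule imageI)
      then show "x \<in> ?f ` cbox a b" by (simp only: inv)
    qed (auto simp only: inv)
    also have "\<dots> \<longleftrightarrow> x \<in> cbox (?f a) (?f b)"
      using all[of "\<lambda>i. a $ i \<le> x $ Transposition.transpose m n i \<and> x $ Transposition.transpose m n i \<le> b $ i"]
      by (simp add: mem_box_cart)
    finally show "x \<in> ?f ` cbox a b \<longleftrightarrow> x \<in> cbox (?f a) (?f b)" .
  qed
  moreover have "(\<Prod>i\<in>UNIV. b $ Transposition.transpose m n i - a $ Transposition.transpose m n i)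
      = (\<Prod>i\<in>UNIV. b $ i - a $ i)"
    by (rule prod.reindex_bij_betw[of _ UNIV UNIV "\<lambda>i. b $ i - a $ i"]) simp
  moreover have "cbox (?f a) (?f b) = {} \<longleftrightarrow> cbox a b = {}"
    using ex[of "\<lambda>i. b $ i < a $ i"] by (simp add: interval_eq_empty_cart)
  ultimately show ?thesis by (simp add: content_cbox_if_cart)
qed

lemma measure_shear_cbox:
  fixes a b :: "real^'n"
  assumes "m \<noteq> n"
  shows "measure lebesgue ((\<lambda>x. \<chi> i. if i = m then x$m + x$n else x$i) ` cbox a b)
    = measure lebesgue (cbox a b)" (is "measure lebesgue (?f ` _) = _")
proof (cases "cbox a b = {}")
  case False
  \<comment> \<open>The shift in coordinate \<open>n\<close> makes the lower corner nonnegative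
    there, as \<open>measure_shear_interval\<close> demands; afterwards translation invariance
    removes it.\<close>
  define c :: "real^'n" where "c = axis n \<bar>a $ n\<bar>"
  have *: "cbox (c + a) (c + b) = (+) c ` cbox a b" by (simp add: cbox_translation)
  have "measure lebesgue (?f ` cbox (c + a) (c + b)) = measure lebesgue (cbox (c + a) (c + b))"
  proof (rule measure_shear_interval)
    show "cbox (c + a) (c + b) \<noteq> {}" using False by (simp add: *)
  qed (use assms in \<open>auto simp: c_def axis_def\<close>)
  also have "?f ` cbox (c + a) (c + b) = (+) (?f c) ` (?f ` cbox a b)"
    unfolding * image_image by (rule image_cong) (auto simp: vec_eq_iff)
  finally show ?thesis by (simp add: * measure_translation)
qed simp

lemma det_swap_map:
  assumes "m \<noteq> n"
  shows "\<bar>det (matrix (\<lambda>x::real^'n. \<chi> i. x $ Transposition.transpose m n i))\<bar> = 1"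
proof -
  have "matrix (\<lambda>x::real^'n. \<chi> i. x $ Transposition.transpose m n i)
      = (\<chi> i. mat 1 $ Transposition.transpose m n i)"
    by (simp add: vec_eq_iff matrix_def mat_def axis_def)
  then show ?thesis
    by (simp add: det_permute_rows permutes_swap_id[of m UNIV n] sign_swap_id abs_mult)
qed

lemma det_shear_map:
  assumes "m \<noteq> n"
  shows "det (matrix (\<lambda>x::real^'n. \<chi> i. if i = m then x$m + x$n else x$i)) = 1"
proof -
  have "matrix (\<lambda>x::real^'n. \<chi> i. if i = m then x$m + x$n else x$i)
      = (\<chi> k. if k = m then row m (mat 1) + 1 *s row n (mat 1) else row k (mat 1))"
    using assms by (auto simp: vec_eq_iff matrix_def mat_def axis_def row_def)
  then show ?thesis using det_row_operation[OF assms, of "mat 1 :: real^'n^'n" 1] by simp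
qed

text \<open>The library's change of variables for linear maps requires a well-ordered index type.\<close>
lemma measure_linear_image_det:
  fixes f :: "real^'n \<Rightarrow> real^'n"
  assumes "linear f"
  shows "\<forall>S \<in> lmeasurable. f ` S \<in> lmeasurable \<and>
    measure lebesgue (f ` S) = \<bar>det (matrix f)\<bar> * measure lebesgue S" (is "?P f")
proof (rule induct_linear_elementary[OF assms])
  fix f g :: "real^'n \<Rightarrow> real^'n"
  assume "linear f" "linear g" "?P f" "?P g"
  then show "?P (f \<circ> g)"
    unfolding image_comp[symmetric] matrix_compose[OF \<open>linear g\<close> \<open>linear f\<close>] det_mul abs_mult
    by (metis mult.assoc)
next
  fix f :: "real^'n \<Rightarrow> real^'n" and i
  assume f: "linear f" "\<And>x. f x $ i = 0"
  have "\<not> surj f"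
  proof
    assume "surj f"
    then obtain x where "f x = axis i 1" by (metis surjD)
    with f(2)[of x] show False by simp
  qed
  then have "\<not> inj f" using linear_injective_imp_surjective[OF f(1)] by blast
  then have "det (matrix f) = 0" "\<And>S. negligible (f ` S)"
    using det_nz_iff_inj[OF f(1)] negligible_linear_singular_image[OF f(1)] by auto
  then show "?P f" using negligible_iff_measure by auto
next
  fix c :: "'n \<Rightarrow> real"
  have "matrix (\<lambda>x. \<chi> i. c i * x $ i) = (\<chi> i j. if i = j then c i else 0)"
    by (auto simp: vec_eq_iff matrix_def axis_def)
  then have "det (matrix (\<lambda>x. \<chi> i. c i * x $ i)) = prod c UNIV"
    by (simp add: det_diagonal)
  then show "?P (\<lambda>x. \<chi> i. c i * x $ i)"
    by (simp add: measurable_stretch measure_stretch)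
next
  fix m n :: 'n assume "m \<noteq> n"
  have lin: "linear (\<lambda>x::real^'n. \<chi> i. x $ Transposition.transpose m n i)"
    by (rule linearI) (simp_all add: vec_eq_iff)
  show "?P (\<lambda>x. \<chi> i. x $ Transposition.transpose m n i)"
    unfolding det_swap_map[OF \<open>m \<noteq> n\<close>]
  proof
    fix S :: "(real^'n) set" assume "S \<in> lmeasurable"
    from measure_linear_sufficient[OF lin this, of 1]
    show "(\<lambda>x. \<chi> i. x $ Transposition.transpose m n i) ` S \<in> lmeasurable \<and>
        measure lebesgue ((\<lambda>x. \<chi> i. x $ Transposition.transpose m n i) ` S) = 1 * measure lebesgue S"
      using measure_swap_cbox by auto
  qed
next
  fix m n :: 'n assume "m \<noteq> n"
  have lin: "linear (\<lambda>x::real^'n. \<chi> i. if i = m then x$m + x$n else x$i)"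
    by (rule linearI) (auto simp: vec_eq_iff algebra_simps)
  show "?P (\<lambda>x. \<chi> i. if i = m then x$m + x$n else x$i)"
    unfolding det_shear_map[OF \<open>m \<noteq> n\<close>]
  proof
    fix S :: "(real^'n) set" assume "S \<in> lmeasurable"
    from measure_linear_sufficient[OF lin this, of 1] 
    show "(\<lambda>x. \<chi> i. if i = m then x$m + x$n else x$i) ` S \<in> lmeasurable \<and>
        measure lebesgue ((\<lambda>x. \<chi> i. if i = m then x$m + x$n else x$i) ` S) = \<bar>1\<bar> * measure lebesgue S"
      using measure_shear_cbox[OF \<open>m \<noteq> n\<close>] by auto
  qed
qed

text \<open>Change of variables as an identity of measures. It is enough to compare boxes: the
  preimage of a box under \<open>A\<close> is its image under the inverse \<open>B\<close>, of
  measure scaled by \<open>\<bar>det B\<bar>\<close>, and the density cancels that factor.\<close>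

lemma lborel_matrix_image:
  fixes A :: "real^'n^'n"
  assumes "det A \<noteq> 0"
  shows "lborel = density (distr lborel borel ((*v) A)) (\<lambda>_. ennreal \<bar>det A\<bar>)"
proof (rule lborel_eqI)
  fix l u :: "real^'n" assume lu: "\<And>b. b \<in> Basis \<Longrightarrow> l \<bullet> b \<le> u \<bullet> b"
  obtain B where B: "A ** B = mat 1" "B ** A = mat 1"
    using assms invertible_det_nz invertible_def by blast
  have vim: "(*v) A -` X = (*v) B ` X" for X
  proof
    show "(*v) A -` X \<subseteq> (*v) B ` X"
    proof
      fix y assume "y \<in> (*v) A -` X"
      then have "B *v (A *v y) \<in> (*v) B ` X" by auto
      then show "y \<in> (*v) B ` X" by (simp only: matrix_vector_mul_assoc B matrix_vector_mul_lid)
    qed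
  qed (auto simp: matrix_vector_mul_assoc B)
  have meas: "(*v) A \<in> borel_measurable borel"
    by (intro borel_measurable_continuous_onI matrix_vector_mult_linear_continuous_on)
  have "det A * det B = 1" using B(1) by (metis det_I det_mul)
  then have dd: "\<bar>det A\<bar> * \<bar>det B\<bar> = 1" by (metis abs_mult abs_one)
  have im: "(*v) B ` box l u \<in> lmeasurable"
    "measure lebesgue ((*v) B ` box l u) = \<bar>det B\<bar> * measure lebesgue (box l u)"
    using measure_linear_image_det[of "(*v) B"] lmeasurable_box[of l u] by auto
  have bor: "(*v) B ` box l u \<in> sets borel"
    using measurable_sets[OF meas, of "box l u"] vim by simp
  have "emeasure (density (distr lborel borel ((*v) A)) (\<lambda>_. ennreal \<bar>det A\<bar>)) (box l u)
      = ennreal \<bar>det A\<bar> * emeasure lborel ((*v) B ` box l u)"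
    using meas by (simp add: emeasure_density nn_integral_cmult emeasure_distr vim)
  also have "emeasure lborel ((*v) B ` box l u) = ennreal (\<bar>det B\<bar> * measure lebesgue (box l u))"
    using emeasure_eq_measure2[OF im(1)] bor unfolding im(2) by simp
  also have "ennreal \<bar>det A\<bar> * \<dots> = ennreal (measure lebesgue (box l u))"
    unfolding ennreal_mult'[OF abs_ge_zero, symmetric] mult.assoc[symmetric] dd by simp
  also have "\<dots> = (\<Prod>b\<in>Basis. (u - l) \<bullet> b)"
    using lu by (simp add: inner_diff_left)
  finally show "emeasure (density (distr lborel borel ((*v) A)) (\<lambda>_. ennreal \<bar>det A\<bar>)) (box l u)
      = (\<Prod>b\<in>Basis. (u - l) \<bullet> b)" .
qed simp

lemma integral_matrix_image:
  fixes A :: "real^'n^'n" and f :: "real^'n \<Rightarrow> real"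
  assumes "det A \<noteq> 0" "f \<in> borel_measurable borel"
  shows "(LINT y|lborel. f y) = \<bar>det A\<bar> * (LINT y|lborel. f (A *v y))"
proof -
  have meas: "(*v) A \<in> borel_measurable borel"
    by (intro borel_measurable_continuous_onI matrix_vector_mult_linear_continuous_on)
  have "(LINT y|lborel. f y) = (LINT y|density (distr lborel borel ((*v) A)) (\<lambda>_. ennreal \<bar>det A\<bar>). f y)"
    using lborel_matrix_image[OF assms(1)] by simp
  also have "\<dots> = (LINT y|distr lborel borel ((*v) A). \<bar>det A\<bar> * f y)"
    by (subst integral_density) (use assms in auto)
  also have "\<dots> = (LINT y|lborel. \<bar>det A\<bar> * f (A *v y))"
    by (rule integral_distr) (use meas assms in auto)
  finally show ?thesis by simp
qed

text \<open>A Bochner integral over the whole space with the set as an indicator, so that linear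
  substitution and additivity in the set are direct. The minus moment body is covered by its value
  at \<open>- x\<close>.\<close>

definition moment_fun :: "(real^'n) set \<Rightarrow> real^'n \<Rightarrow> real"
  where "moment_fun K x = (LINT y|lborel. indicator K y * max (x \<bullet> y) 0)"

lemma integrable_moment:
  assumes "compact K"
  shows "integrable lborel (\<lambda>y. indicator K y * max (x \<bullet> y) 0)"
  using borel_integrable_compact[OF assms, of "\<lambda>y. max (x \<bullet> y) 0"]
  by (simp add: continuous_intros)

lemma integral_eq_moment_fun:
  assumes "compact K"
  shows "integral K (\<lambda>y. max (x \<bullet> y) 0) = moment_fun K x"
proof -
  have "set_integrable lborel K (\<lambda>y. max (x \<bullet> y) 0)"
    using integrable_moment[OF assms] by (simp add: set_integrable_def)
  from set_borel_integral_eq_integral(2)[OF this] show ?thesis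
    by (simp add: moment_fun_def set_lebesgue_integral_def)
qed

lemma moment_fun_nonneg: "0 \<le> moment_fun K x"
  unfolding moment_fun_def by (rule integral_nonneg_AE) auto

lemma moment_fun_matrix_image:
  assumes "compact K" "det A \<noteq> 0"
  shows "moment_fun ((*v) A ` K) x = \<bar>det A\<bar> * moment_fun K (transpose A *v x)"
proof -
  have inj: "inj ((*v) A)" using assms(2) invertible_det_nz inj_matrix_vector_mult by blast
  have "compact ((*v) A ` K)"
    by (intro compact_continuous_image assms matrix_vector_mult_linear_continuous_on)
  then have bor: "(\<lambda>y. indicator ((*v) A ` K) y * max (x \<bullet> y) 0) \<in> borel_measurable borel"
    using borel_measurable_integrable[OF integrable_moment] by simp
  show ?thesis
    unfolding moment_fun_def integral_matrix_image[OF assms(2) bor]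
    by (simp add: indicator_def inj_image_mem_iff[OF inj] dot_lmul_matrix)
qed

lemma moment_fun_valuation:
  assumes "compact K" "compact L"
  shows "moment_fun (K \<union> L) x + moment_fun (K \<inter> L) x = moment_fun K x + moment_fun L x"
proof -
  have "compact (K \<union> L)" "compact (K \<inter> L)" using assms by auto
  then show ?thesis
    unfolding moment_fun_def
      Bochner_Integration.integral_add[OF integrable_moment integrable_moment, symmetric,
        OF \<open>compact (K \<union> L)\<close> \<open>compact (K \<inter> L)\<close>]
      Bochner_Integration.integral_add[OF integrable_moment integrable_moment, symmetric, OF assms]
    by (intro Bochner_Integration.integral_cong) (auto simp: indicator_def)
qed

text \<open>The witness is the moment vector of the part of \<open>K\<close> on which
  \<open>x0\<close> is positive. Replacing \<open>max (x \<bullet> y) 0\<close> by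
  \<open>x \<bullet> y\<close> on that part and by 0 elsewhere can only decrease it, and changes
  nothing for \<open>x = x0\<close>.\<close>

lemma moment_fun_attained:
  assumes "compact K"
  shows "\<exists>z. (\<forall>x. x \<bullet> z \<le> moment_fun K x) \<and> x0 \<bullet> z = moment_fun K x0"
proof -
  define J where "J = {y. x0 \<bullet> y > 0}"
  define z where "z = (LINT y|lborel. indicator J y *\<^sub>R (indicator K y *\<^sub>R y))"
  have J: "J \<in> sets borel" unfolding J_def by (intro borel_open open_halfspace_gt)
  have int: "integrable lborel (\<lambda>y. indicator J y *\<^sub>R (indicator K y *\<^sub>R y))"
    by (rule integrable_mult_indicator) (use J borel_integrable_compact[OF assms, of "\<lambda>y. y"] in auto)
  have xz: "x \<bullet> z = (LINT y|lborel. x \<bullet> (indicator J y *\<^sub>R (indicator K y *\<^sub>R y)))" for x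
    unfolding z_def using int by (simp del: inner_scaleR_right)
  have "x \<bullet> z \<le> moment_fun K x" for x
    unfolding xz moment_fun_def
    by (rule integral_mono) (use int integrable_moment[OF assms] in \<open>auto simp: indicator_def simp del: inner_scaleR_right\<close>)
  moreover have "x0 \<bullet> z = moment_fun K x0"
    unfolding xz moment_fun_def
    by (rule Bochner_Integration.integral_cong) (auto simp: indicator_def J_def)
  ultimately show ?thesis by blast
qed

text \<open>\<open>moment_fun_attained\<close> makes each half-space of the intersection tight; the
  directions \<open>axis i 1\<close> and \<open>axis i (-1)\<close> bound the body.\<close>

lemma body_of_support_moment:
  assumes "compact K"
  defines "B \<equiv> body_of_support (moment_fun K)"
  shows "compact B" "convex B" "0 \<in> B" "support_fun B x = moment_fun K x"
proof -
  have B: "B = (\<Inter>x. {z. x \<bullet> z \<le> moment_fun K x})" by (auto simp: B_def body_of_support_def)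
  have "closed B" unfolding B by (intro closed_INT ballI closed_halfspace_le)
  moreover have "bounded B"
  proof (rule bounded_subset[OF bounded_cbox])
    show "B \<subseteq> cbox (\<chi> i. - moment_fun K (axis i (-1))) (\<chi> i. moment_fun K (axis i 1))"
    proof
      fix z assume "z \<in> B"
      then have "axis i c \<bullet> z \<le> moment_fun K (axis i c)" for i c by (auto simp: B)
      then have "c * z $ i \<le> moment_fun K (axis i c)" for i c by (simp add: inner_axis')
      from this[of "-1"] this[of 1] have "- moment_fun K (axis i (-1)) \<le> z $ i" "z $ i \<le> moment_fun K (axis i 1)" for i
        by (simp_all add: minus_le_iff[of "moment_fun K (axis i (-1))"])
      then show "z \<in> cbox (\<chi> i. - moment_fun K (axis i (-1))) (\<chi> i. moment_fun K (axis i 1))"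
        by (simp add: mem_box_cart)
    qed
  qed
  ultimately show "compact B" using compact_eq_bounded_closed by blast
  show "convex B" unfolding B by (intro convex_INT convex_halfspace_le)
  show "0 \<in> B" by (simp add: B moment_fun_nonneg)
  show "support_fun B x = moment_fun K x"
    using moment_fun_attained[OF assms(1), of x] by (auto simp: B intro!: support_fun_eqI)
qed

lemma moment_plus_eq: "compact K \<Longrightarrow> moment_plus K = body_of_support (moment_fun K)"
  by (simp add: moment_plus_def integral_eq_moment_fun)

lemma moment_minus_eq:
  assumes "compact K"
  shows "moment_minus K = uminus ` body_of_support (moment_fun K)"
proof -
  have "moment_minus K = body_of_support (\<lambda>x. moment_fun K (- x))"
    using integral_eq_moment_fun[OF assms, of "- _"] by (simp add: moment_minus_def)
  also have "\<dots> = uminus ` body_of_support (moment_fun K)"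
  proof (rule set_eqI)
    fix z
    have "z \<in> uminus ` body_of_support (moment_fun K) \<longleftrightarrow> - z \<in> body_of_support (moment_fun K)"
      by (metis image_iff minus_minus)
    also have "\<dots> \<longleftrightarrow> z \<in> body_of_support (\<lambda>x. moment_fun K (- x))"
    proof
      assume z: "- z \<in> body_of_support (moment_fun K)"
      have "x \<bullet> z \<le> moment_fun K (- x)" for x
        using z[unfolded body_of_support_def mem_Collect_eq, rule_format, of "- x"] by simp
      then show "z \<in> body_of_support (\<lambda>x. moment_fun K (- x))" by (simp add: body_of_support_def)
    next
      assume z: "z \<in> body_of_support (\<lambda>x. moment_fun K (- x))"
      have "x \<bullet> - z \<le> moment_fun K x" for x
        using z[unfolded body_of_support_def mem_Collect_eq, rule_format, of "- x"] by simp
      then show "- z \<in> body_of_support (moment_fun K)" unfolding body_of_support_def by blast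
    qed
    finally show "z \<in> body_of_support (\<lambda>x. moment_fun K (- x)) \<longleftrightarrow> z \<in> uminus ` body_of_support (moment_fun K)" by simp
  qed
  finally show ?thesis .
qed

lemma support_fun_uminus: "support_fun (uminus ` K) x = support_fun K (- x)"
  by (simp add: support_fun_def image_image)

lemma moment_plus_body:
  assumes "compact K"
  shows "compact (moment_plus K)" "convex (moment_plus K)" "moment_plus K \<noteq> {}"
    "support_fun (moment_plus K) x = moment_fun K x"
  using body_of_support_moment[OF assms] by (auto simp: moment_plus_eq assms)

lemma moment_minus_body:
  assumes "compact K"
  shows "compact (moment_minus K)" "convex (moment_minus K)" "moment_minus K \<noteq> {}"
    "support_fun (moment_minus K) x = moment_fun K (- x)"
  using body_of_support_moment[OF assms]
  by (auto simp: moment_minus_eq assms support_fun_uminus compact_negations convex_negations)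

section \<open>The outer face and the body D\<close>

text \<open>The facet opposite to the origin, described by the set alone and not by a vertex list.
  This makes D a function of \<open>T\<close>, compatible with unions, intersections and linear
  images. For \<open>{0}\<close> it is empty.\<close>

definition outer_face :: "'a::real_vector set \<Rightarrow> 'a set"
  where "outer_face T = {y \<in> T. \<forall>c>1. c *\<^sub>R y \<notin> T}"

lemma independent_functional_one:
  assumes "independent V"
  obtains f :: "'a::euclidean_space \<Rightarrow> real" where "linear f" "\<And>b. b \<in> convex hull V \<Longrightarrow> f b = 1"
proof -
  obtain f :: "'a \<Rightarrow> real" where f: "linear f" "\<And>v. v \<in> V \<Longrightarrow> f v = 1"
    using linear_independent_extend[OF assms, of "\<lambda>_. 1"] by auto
  have "convex {b. f b = 1}"
    unfolding convex_def using f(1) by (auto simp: linear_add linear_scale)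
  then have "convex hull V \<subseteq> {b. f b = 1}" using f(2) by (intro hull_minimal) auto
  then show ?thesis using that f by blast
qed

text \<open>The functional equal to 1 on the hull of \<open>V\<close> takes the value
  \<open>v\<close> at a point \<open>v *\<^sub>R b\<close> of the simplex, so it never exceeds 1
  there, and only points with \<open>v = 1\<close> cannot be pushed outwards.\<close>

lemma outer_face_simplex:
  fixes V :: "'a::euclidean_space set"
  assumes "independent V"
  shows "outer_face (convex hull (insert 0 V)) = convex hull V"
proof (cases "V = {}")
  case True
  then show ?thesis by (auto simp: outer_face_def intro: exI[of _ 2])
next
  case False
  obtain f :: "'a \<Rightarrow> real" where f: "linear f" "\<And>b. b \<in> convex hull V \<Longrightarrow> f b = 1"
    using independent_functional_one[OF assms] by metis
  have T: "y \<in> convex hull (insert 0 V) \<longleftrightarrow> (\<exists>v b. 0 \<le> v \<and> v \<le> 1 \<and> b \<in> convex hull V \<and> y = v *\<^sub>R b)" for y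
  proof -
    have "y \<in> convex hull (insert 0 V) \<longleftrightarrow>
      (\<exists>u\<ge>0. \<exists>v\<ge>0. \<exists>b. u + v = 1 \<and> b \<in> convex hull V \<and> y = v *\<^sub>R b)"
      by (simp add: convex_hull_insert[OF False])
    also have "\<dots> \<longleftrightarrow> (\<exists>v b. 0 \<le> v \<and> v \<le> 1 \<and> b \<in> convex hull V \<and> y = v *\<^sub>R b)"
    proof
      assume "\<exists>v b. 0 \<le> v \<and> v \<le> 1 \<and> b \<in> convex hull V \<and> y = v *\<^sub>R b"
      then obtain v b where "0 \<le> v" "v \<le> 1" "b \<in> convex hull V" "y = v *\<^sub>R b" by blast
      then have "1 - v \<ge> 0 \<and> v \<ge> 0 \<and> (1 - v) + v = 1 \<and> b \<in> convex hull V \<and> y = v *\<^sub>R b" by simp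
      then show "\<exists>u\<ge>0. \<exists>v\<ge>0. \<exists>b. u + v = 1 \<and> b \<in> convex hull V \<and> y = v *\<^sub>R b" by blast
    next
      assume "\<exists>u\<ge>0. \<exists>v\<ge>0. \<exists>b. u + v = 1 \<and> b \<in> convex hull V \<and> y = v *\<^sub>R b"
      then show "\<exists>v b. 0 \<le> v \<and> v \<le> 1 \<and> b \<in> convex hull V \<and> y = v *\<^sub>R b" by fastforce
    qed
    finally show ?thesis .
  qed
  show ?thesis
  proof (intro equalityI subsetI)
    fix y assume y: "y \<in> outer_face (convex hull (insert 0 V))"
    then obtain v b where vb: "0 \<le> v" "v \<le> 1" "b \<in> convex hull V" "y = v *\<^sub>R b"
      using T by (auto simp: outer_face_def)
    have no: "c *\<^sub>R y \<notin> convex hull (insert 0 V)" if "c > 1" for c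
      using y that by (auto simp: outer_face_def)
    have "v = 1"
    proof (rule ccontr)
      assume "v \<noteq> 1"
      show False
      proof (cases "v = 0")
        case True
        then show False using no[of 2] y vb by (simp add: outer_face_def)
      next
        case False
        have "b \<in> convex hull (insert 0 V)"
          using vb(3) hull_mono[of V "insert 0 V" convex] by auto
        then show False using no[of "1 / v"] vb False \<open>v \<noteq> 1\<close> by simp
      qed
    qed
    then show "y \<in> convex hull V" using vb by simp
  next
    fix b assume b: "b \<in> convex hull V"
    have "c *\<^sub>R b \<notin> convex hull (insert 0 V)" if "c > 1" for c
    proof
      assume "c *\<^sub>R b \<in> convex hull (insert 0 V)"
      then obtain v b' where v: "v \<le> 1" "b' \<in> convex hull V" "c *\<^sub>R b = v *\<^sub>R b'" using T by blast
      from arg_cong[OF v(3), of f] have "c * f b = v * f b'" using f(1) by (simp add: linear_scale)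
      then have "c = v" using f(2) b v(2) by simp
      then show False using v that by simp
    qed
    moreover have "b \<in> convex hull (insert 0 V)"
      using b hull_mono[of V "insert 0 V" convex] by auto
    ultimately show "b \<in> outer_face (convex hull (insert 0 V))" by (simp add: outer_face_def)
  qed
qed

lemma origin_simplexD:
  fixes T :: "(real^'n) set"
  assumes "T \<in> origin_simplices"
  shows "compact T" "convex T" "0 \<in> T" "compact (outer_face T)" "convex (outer_face T)"
  using assms
  by (auto simp: origin_simplices_def outer_face_simplex finite_imp_compact_convex_hull hull_inc)

lemma origin_simplex_functional:
  fixes T :: "(real^'n) set"
  assumes "T \<in> origin_simplices"
  obtains f :: "real^'n \<Rightarrow> real" where "linear f" "\<forall>b \<in> outer_face T. f b = 1"
proof -
  obtain V where V: "finite V" "independent V" "T = convex hull (insert 0 V)"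
    using assms by (auto simp: origin_simplices_def)
  show ?thesis
    by (rule independent_functional_one[OF V(2)]) (rule that, auto simp: V(3) outer_face_simplex[OF V(2)])
qed

lemma origin_simplex_ray:
  fixes T :: "(real^'n) set"
  assumes "T \<in> origin_simplices" "y \<in> T" "y \<noteq> 0"
  obtains c where "c \<ge> 1" "c *\<^sub>R y \<in> outer_face T"
proof -
  obtain V where V: "finite V" "independent V" "T = convex hull (insert 0 V)"
    using assms by (auto simp: origin_simplices_def)
  have "V \<noteq> {}" using assms V(3) by auto
  with assms V(3) obtain u v b where uvb: "u \<ge> 0" "v \<ge> 0" "u + v = 1" "b \<in> convex hull V" "y = v *\<^sub>R b"
    by (auto simp: convex_hull_insert)
  then have "v \<noteq> 0" using assms(3) by auto
  with uvb show ?thesis using outer_face_simplex[OF V(2)] V(3) by (intro that[of "1 / v"]) auto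
qed

lemma zero_notin_outer_face: "0 \<notin> outer_face T"
  by (auto simp: outer_face_def intro: exI[of _ 2])

lemma convex_zero_scale_mem:
  assumes "convex L" "0 \<in> L" "c *\<^sub>R z \<in> L" "c \<ge> 1"
  shows "z \<in> L"
proof -
  have "(1 - 1 / c) *\<^sub>R 0 + (1 / c) *\<^sub>R (c *\<^sub>R z) \<in> L"
    by (rule convexD[OF assms(1)]) (use assms in auto)
  then show ?thesis using assms(4) by simp
qed

text \<open>A point of the outer face of \<open>K\<close> interior to a ray of \<open>L\<close> would, on the segment of the outer
  face of \<open>K \<union> L\<close> towards a point outside \<open>L\<close>, force the functional that is 1 on the outer face
  of \<open>K\<close> to exceed 1.\<close>
lemma outer_face_subset_Un:
  fixes K L :: "(real^'n) set"
  assumes K: "K \<in> origin_simplices" and L: "L \<in> origin_simplices" and T: "K \<union> L \<in> origin_simplices"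
    and nsub: "\<not> K \<subseteq> L"
  shows "outer_face K \<subseteq> outer_face (K \<union> L)"
proof
  fix y assume y: "y \<in> outer_face K"
  obtain f :: "real^'n \<Rightarrow> real" where "linear f" "\<forall>b \<in> outer_face K. f b = 1"
    by (rule origin_simplex_functional[OF K])
  then have f: "linear f" "\<And>b. b \<in> outer_face K \<Longrightarrow> f b = 1" by auto
  note pK = origin_simplexD[OF K] and pL = origin_simplexD[OF L] and pT = origin_simplexD[OF T]
  show "y \<in> outer_face (K \<union> L)"
  proof (rule ccontr)
    assume "y \<notin> outer_face (K \<union> L)"
    with y obtain c where c: "c > 1" "c *\<^sub>R y \<in> K \<union> L" by (auto simp: outer_face_def)
    have "y \<noteq> 0" using y zero_notin_outer_face by metis
    then have "c *\<^sub>R y \<noteq> 0" using c(1) by simp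
    then obtain s where s: "s \<ge> 1" "s *\<^sub>R c *\<^sub>R y \<in> outer_face (K \<union> L)"
      using origin_simplex_ray[OF T c(2)] by blast
    have "1 * c \<le> s * c" using s c by (intro mult_right_mono) auto
    then have sc: "s * c > 1" using c(1) by linarith
    define q1 where "q1 = (s * c) *\<^sub>R y"
    have q1: "q1 \<in> outer_face (K \<union> L)" using s by (simp add: q1_def)
    moreover have "q1 \<notin> K" using y sc by (simp add: q1_def outer_face_def)
    ultimately have q1L: "q1 \<in> L" by (auto simp: outer_face_def)
    obtain z where z: "z \<in> K" "z \<notin> L" using nsub by blast
    then have "z \<noteq> 0" using pL(3) by metis
    then obtain d where d: "d \<ge> 1" "d *\<^sub>R z \<in> outer_face K" using origin_simplex_ray[OF K z(1)] by blast
    have dL: "d *\<^sub>R z \<notin> L" using convex_zero_scale_mem[OF pL(2,3) _ d(1)] z by blast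
    have dT: "d *\<^sub>R z \<in> outer_face (K \<union> L)"
    proof -
      have "e *\<^sub>R d *\<^sub>R z \<notin> L" if "e > 1" for e
        using convex_zero_scale_mem[OF pL(2,3), of e "d *\<^sub>R z"] dL that by auto
      then show ?thesis using d(2) by (auto simp: outer_face_def)
    qed
    obtain q where q: "q \<in> K" "q \<in> L" "q \<in> closed_segment (d *\<^sub>R z) q1"
      using convex_union_meets[OF _ _ pT(2) _ q1L, of "d *\<^sub>R z"] d(2) pK(1) pL(1) compact_imp_closed
      by (auto simp: outer_face_def)
    have "q \<in> outer_face (K \<union> L)"
      using closed_segment_subset[OF dT q1 pT(5)] q(3) by blast
    then have "q \<in> outer_face K" using q(1) by (auto simp: outer_face_def)
    then have fq: "f q = 1" by (rule f(2))
    obtain t where t: "0 \<le> t" "q = (1 - t) *\<^sub>R (d *\<^sub>R z) + t *\<^sub>R q1"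
      using q(3) by (auto simp: in_segment)
    have fz: "f (d *\<^sub>R z) = 1" using f(2) d(2) by blast
    have "f q1 = s * c" unfolding q1_def using f(2)[OF y] by (simp add: linear_scale[OF f(1)])
    then have "1 = (1 - t) + t * (s * c)"
      using fq fz by (simp add: t(2) linear_add[OF f(1)] linear_scale[OF f(1)] del: scaleR_scaleR)
    \<comment> \<open>\<open>f\<close> is 1 at \<open>q\<close> and at \<open>d *\<^sub>R z\<close>
      but \<open>s * c > 1\<close> at \<open>q1\<close>, so \<open>q\<close> can only be the
      endpoint \<open>d *\<^sub>R z\<close>, which is not in \<open>L\<close>.\<close>
    then have "t * (s * c - 1) = 0" by (simp add: algebra_simps)
    then have "t = 0" using sc by simp
    then show False using t(2) q(2) dL by simp
  qed
qed

text \<open>Both outer faces lie in that of the union, hence in one hyperplane \<open>f = 1\<close>.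
  A ray through a common point therefore leaves \<open>K\<close> and \<open>L\<close> at the same
  place. If one simplex contained the other, the smaller outer face could lie inside the larger
  simplex; that case is trivial for valuations.\<close>

lemma outer_face_Un_Int:
  fixes K L :: "(real^'n) set"
  assumes K: "K \<in> origin_simplices" and L: "L \<in> origin_simplices" and T: "K \<union> L \<in> origin_simplices"
    and nsub: "\<not> K \<subseteq> L" "\<not> L \<subseteq> K"
  shows "outer_face (K \<union> L) = outer_face K \<union> outer_face L"
    and "outer_face (K \<inter> L) = outer_face K \<inter> outer_face L"
proof -
  have sub: "outer_face K \<subseteq> outer_face (K \<union> L)" "outer_face L \<subseteq> outer_face (K \<union> L)"
    using outer_face_subset_Un[OF K L T nsub(1)] outer_face_subset_Un[of L K] K L T nsub(2)
    by (auto simp: Un_commute)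
  then show "outer_face (K \<union> L) = outer_face K \<union> outer_face L" by (auto simp: outer_face_def)
  obtain f :: "real^'n \<Rightarrow> real" where "linear f" "\<forall>b \<in> outer_face (K \<union> L). f b = 1"
    by (rule origin_simplex_functional[OF T])
  then have f: "linear f" "\<And>b. b \<in> outer_face (K \<union> L) \<Longrightarrow> f b = 1" by auto
  show "outer_face (K \<inter> L) = outer_face K \<inter> outer_face L"
  proof (intro equalityI subsetI)
    fix y assume y: "y \<in> outer_face (K \<inter> L)"
    then have "y \<in> K" "y \<in> L" "y \<noteq> 0" using zero_notin_outer_face[of "K \<inter> L"] by (auto simp: outer_face_def)
    obtain c where c: "c \<ge> 1" "c *\<^sub>R y \<in> outer_face K"
      by (rule origin_simplex_ray[OF K \<open>y \<in> K\<close> \<open>y \<noteq> 0\<close>])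
    obtain d where d: "d \<ge> 1" "d *\<^sub>R y \<in> outer_face L"
      by (rule origin_simplex_ray[OF L \<open>y \<in> L\<close> \<open>y \<noteq> 0\<close>])
    have "c * f y = 1" "d * f y = 1"
      using f(2)[of "c *\<^sub>R y"] f(2)[of "d *\<^sub>R y"] c d sub by (auto simp: linear_scale[OF f(1)])
    then have "c = d" by (metis mult_cancel_right mult_zero_right zero_neq_one)
    then have "c *\<^sub>R y \<in> K \<inter> L" using c d by (auto simp: outer_face_def)
    then have "\<not> c > 1" using y by (auto simp: outer_face_def)
    then have "c = 1" using c(1) by simp
    then show "y \<in> outer_face K \<inter> outer_face L" using c d \<open>c = d\<close> by simp
  qed (auto simp: outer_face_def)
qed

text \<open>With \<open>M\<close> and \<open>m\<close> the maximum and minimum of \<open>x\<close>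
  on the outer face this is \<open>a2 * M - b2 * m\<close> for \<open>m \<le> 0 \<le> M\<close>,
  \<open>a2 * M - (a2 - a1) * m\<close> for \<open>m \<ge> 0\<close>, and
  \<open>(b2 - b1) * M - b2 * m\<close> for \<open>M \<le> 0\<close>: one case for each family of
  points in \<open>D_body\<close>.\<close>

definition D_form :: "real \<Rightarrow> real \<Rightarrow> real \<Rightarrow> real \<Rightarrow> real \<Rightarrow> real \<Rightarrow> real"
  where "D_form a1 a2 b1 b2 M m =
    a2 * max M 0 + b2 * max (- m) 0 - (a2 - a1) * max m 0 - (b2 - b1) * max (- M) 0"

definition D_fun :: "real \<Rightarrow> real \<Rightarrow> real \<Rightarrow> real \<Rightarrow> (real^'n) set \<Rightarrow> real^'n \<Rightarrow> real"
  where "D_fun a1 a2 b1 b2 T x = (if outer_face T = {} then 0 else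
    D_form a1 a2 b1 b2 (support_fun (outer_face T) x) (- support_fun (outer_face T) (- x)))"

text \<open>\<open>D_form\<close> is a function of \<open>M\<close> plus a function of
  \<open>m\<close>, and passing to maximum and minimum only permutes the arguments. The second
  arguments are negated because the minimum is minus the support function at
  \<open>- x\<close>.\<close>

lemma D_form_max_min:
  "D_form a1 a2 b1 b2 (max M M') (- max m m') + D_form a1 a2 b1 b2 (min M M') (- min m m')
    = D_form a1 a2 b1 b2 M (- m) + D_form a1 a2 b1 b2 M' (- m')"
  unfolding D_form_def by (cases "M \<le> M'"; cases "m \<le> m'") (simp_all add: max.absorb1 max.absorb2 min.absorb1 min.absorb2)

lemma D_fun_valuation:
  fixes K L :: "(real^'n) set"
  assumes K: "K \<in> origin_simplices" and L: "L \<in> origin_simplices" and T: "K \<union> L \<in> origin_simplices"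
  shows "D_fun a1 a2 b1 b2 (K \<union> L) x + D_fun a1 a2 b1 b2 (K \<inter> L) x
    = D_fun a1 a2 b1 b2 K x + D_fun a1 a2 b1 b2 L x"
proof (cases "K \<subseteq> L \<or> L \<subseteq> K")
  case True
  then show ?thesis by (auto simp: Un_absorb1 Un_absorb2 Int_absorb1 Int_absorb2)
next
  case False
  then have nsub: "\<not> K \<subseteq> L" "\<not> L \<subseteq> K" by auto
  have cK: "compact (outer_face K)" "0 \<in> K" and cL: "compact (outer_face L)" "0 \<in> L"
    using origin_simplexD[OF K] origin_simplexD[OF L] by auto
  have cT: "convex (outer_face K \<union> outer_face L)"
    using origin_simplexD(5)[OF T] outer_face_Un_Int(1)[OF K L T nsub] by simp
  have nK: "outer_face K \<noteq> {}"
  proof -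
    obtain z where "z \<in> K" "z \<noteq> 0" using nsub cL(2) by (metis subsetI)
    then show ?thesis using origin_simplex_ray[OF K] by blast
  qed
  have nL: "outer_face L \<noteq> {}"
  proof -
    obtain z where "z \<in> L" "z \<noteq> 0" using nsub cK(2) by (metis subsetI)
    then show ?thesis using origin_simplex_ray[OF L] by blast
  qed
  note Un = support_fun_Un[OF cK(1) cL(1) nK nL] and Int = support_fun_Int[OF cK(1) cL(1) nK nL cT]
  show ?thesis
    unfolding D_fun_def outer_face_Un_Int[OF K L T nsub] using nK nL Int(1)
    by (simp add: Un Int(2) D_form_max_min)
qed

lemma outer_face_linear_image:
  assumes "linear g" "inj g"
  shows "outer_face (g ` T) = g ` outer_face T"
proof -
  have "c *\<^sub>R g y \<in> g ` T \<longleftrightarrow> c *\<^sub>R y \<in> T" for c y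
    using inj_image_mem_iff[OF assms(2)] linear_scale[OF assms(1)] by metis
  then show ?thesis by (auto simp: outer_face_def)
qed

lemma D_fun_matrix_image:
  fixes Q :: "real^'n^'n"
  assumes "det Q \<noteq> 0"
  shows "D_fun a1 a2 b1 b2 ((*v) Q ` T) x = D_fun a1 a2 b1 b2 T (transpose Q *v x)"
proof -
  have inj: "inj ((*v) Q)" using assms invertible_det_nz inj_matrix_vector_mult by blast
  have "outer_face ((*v) Q ` T) = (*v) Q ` outer_face T"
    using inj by (intro outer_face_linear_image) auto
  moreover have "transpose Q *v (- x) = - (transpose Q *v x)" by (rule vec.neg)
  ultimately show ?thesis by (simp only: D_fun_def support_fun_matrix_image image_is_empty)
qed

lemma D_fun_homogeneous:
  assumes "T \<in> origin_simplices" "c \<ge> 0"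
  shows "D_fun a1 a2 b1 b2 T (c *\<^sub>R x) = c * D_fun a1 a2 b1 b2 T x"
proof (cases "outer_face T = {}")
  case False
  have "compact (outer_face T)" using origin_simplexD(4)[OF assms(1)] .
  note h = support_fun_homogeneous[OF this False assms(2)]
  have h': "support_fun (outer_face T) (- (c *\<^sub>R x)) = c * support_fun (outer_face T) (- x)"
    using h[of "- x"] by simp
  have m: "max (c * t) 0 = c * max t 0" "max (- (c * t)) 0 = c * max (- t) 0" for t
    using assms(2) by (simp_all add: max_mult_distrib_left)
  show ?thesis
    using False by (simp add: D_fun_def D_form_def h h' m right_diff_distrib distrib_left mult.left_commute)
qed (simp add: D_fun_def)

lemma continuous_on_D_fun:
  assumes "T \<in> origin_simplices"
  shows "continuous_on UNIV (D_fun a1 a2 b1 b2 T)"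
proof (cases "outer_face T = {}")
  case False
  have "compact (outer_face T)" using origin_simplexD(4)[OF assms(1)] .
  note c = continuous_on_support_fun[OF this False]
  have c': "continuous_on UNIV (\<lambda>x. support_fun (outer_face T) (- x))"
    by (rule continuous_on_compose2[OF c]) (auto intro: continuous_intros)
  show ?thesis
    unfolding D_fun_def D_form_def using False by (auto intro!: continuous_intros c c')
qed (simp add: D_fun_def)

text \<open>\<open>a2 - a1 \<le> b2\<close> and \<open>b2 - b1 \<le> a2\<close> make
  \<open>D_form\<close> the largest of its three linear expressions; \<open>a1 \<le> a2\<close> and
  \<open>b1 \<le> b2\<close> keep their coefficients of the right sign, so that each family is
  maximized at a vertex \<open>p\<close> with value \<open>M\<close> and a vertex \<open>q\<close>
  with value \<open>m\<close>. For a single vertex \<open>M = m\<close>, which leaves the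
  segment.\<close>

lemma support_fun_D_body:
  fixes V :: "(real^'n) set"
  assumes V: "finite V" "independent V"
    and ab: "a1 \<ge> 0" "a2 \<ge> 0" "b1 \<ge> 0" "b2 \<ge> 0" "a1 \<le> a2" "b1 \<le> b2" "a2 - a1 \<le> b2" "b2 - b1 \<le> a2"
  shows "compact (D_body a1 a2 b1 b2 V)" "convex (D_body a1 a2 b1 b2 V)" "D_body a1 a2 b1 b2 V \<noteq> {}"
    "support_fun (D_body a1 a2 b1 b2 V) x = D_fun a1 a2 b1 b2 (convex hull (insert 0 V)) x"
proof -
  define P where "P = {a2 *\<^sub>R vi - b2 *\<^sub>R vj | vi vj. vi \<in> V \<and> vj \<in> V}
                  \<union> {a2 *\<^sub>R vi - (a2 - a1) *\<^sub>R vj | vi vj. vi \<in> V \<and> vj \<in> V}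
                  \<union> {(b2 - b1) *\<^sub>R vi - b2 *\<^sub>R vj | vi vj. vi \<in> V \<and> vj \<in> V}"
  have finP: "finite P" unfolding P_def using V(1) by (intro finite_UnI finite_image_set2) auto
  consider (0) "card V = 0" | (1) "card V = 1" | (2) "card V \<ge> 2" by linarith
  then have "compact (D_body a1 a2 b1 b2 V) \<and> convex (D_body a1 a2 b1 b2 V) \<and> D_body a1 a2 b1 b2 V \<noteq> {} \<and>
    support_fun (D_body a1 a2 b1 b2 V) x = D_fun a1 a2 b1 b2 (convex hull (insert 0 V)) x"
  proof cases
    case 0
    then have "V = {}" using V by simp
    then have "D_body a1 a2 b1 b2 V = {0}" "D_fun a1 a2 b1 b2 (convex hull (insert 0 V)) x = 0"
      unfolding D_body_def D_fun_def outer_face_simplex[OF V(2)] by auto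
    moreover have "support_fun {0} x = 0" by (rule support_fun_eqI[of 0]) auto
    ultimately show ?thesis by simp
  next
    case 1
    then obtain v where v: "V = {v}" using card_1_singletonE by blast
    define t where "t = x \<bullet> v"
    have D: "D_body a1 a2 b1 b2 V = convex hull {- b1 *\<^sub>R v, a1 *\<^sub>R v}"
      by (simp add: D_body_def v segment_convex_hull)
    have "support_fun (convex hull {v}) y = y \<bullet> v" for y
      using support_fun_convex_hull_finite[of "{v}" y] by simp
    then have "D_fun a1 a2 b1 b2 (convex hull (insert 0 V)) x = D_form a1 a2 b1 b2 t t"
      unfolding D_fun_def outer_face_simplex[OF V(2)] by (simp add: v t_def)
    also have "\<dots> = max (- b1 * t) (a1 * t)"
    proof (cases "t \<ge> 0")
      case True
      then have "b1 * t \<ge> 0" "a1 * t \<ge> 0" using ab by auto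
      then show ?thesis using True by (simp add: D_form_def max_def algebra_simps)
    next
      case False
      then have "b1 * t \<le> 0" "a1 * t \<le> 0" using ab by (auto simp: mult_nonneg_nonpos)
      then show ?thesis using False by (simp add: D_form_def max_def algebra_simps)
    qed
    also have "\<dots> = support_fun (D_body a1 a2 b1 b2 V) x"
      using support_fun_convex_hull_finite[of "{- b1 *\<^sub>R v, a1 *\<^sub>R v}" x] by (simp add: D t_def)
    finally show ?thesis by (simp add: D finite_imp_compact_convex_hull)
  next
    case 2
    then have Vn: "V \<noteq> {}" by auto
    have D: "D_body a1 a2 b1 b2 V = convex hull P" using 2 by (simp add: D_body_def P_def)
    define M where "M = Max ((\<bullet>) x ` V)"
    define m where "m = Min ((\<bullet>) x ` V)"
    obtain p where p: "p \<in> V" "x \<bullet> p = M"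
      using Max_in[of "(\<bullet>) x ` V"] V(1) Vn unfolding M_def by fastforce
    obtain q where q: "q \<in> V" "x \<bullet> q = m"
      using Min_in[of "(\<bullet>) x ` V"] V(1) Vn unfolding m_def by fastforce
    have bd: "m \<le> x \<bullet> v" "x \<bullet> v \<le> M" if "v \<in> V" for v
      using that V(1) by (auto simp: M_def m_def)
    have mM: "m \<le> M" using bd p by blast
    have sM: "support_fun (convex hull V) x = M"
      using support_fun_convex_hull_finite[OF V(1) Vn] by (simp add: M_def)
    have sm: "support_fun (convex hull V) (- x) = - m"
    proof (rule support_fun_eqI)
      show "q \<in> convex hull V" using q by (simp add: hull_inc)
      have "convex hull V \<subseteq> {y. m \<le> x \<bullet> y}"
        by (rule hull_minimal) (use bd in \<open>auto simp: convex_halfspace_ge\<close>)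
      then show "- x \<bullet> y \<le> - m" if "y \<in> convex hull V" for y using that by auto
    qed (use q in simp)
    have Df: "D_fun a1 a2 b1 b2 (convex hull (insert 0 V)) x = D_form a1 a2 b1 b2 M m"
      using Vn by (simp add: D_fun_def outer_face_simplex[OF V(2)] sM sm)
    have mono: "s * xi - r * xj \<le> s * M - r * m" if "s \<ge> 0" "r \<ge> 0" "xi \<le> M" "m \<le> xj" for s r xi xj
      using that by (simp add: diff_mono mult_left_mono)
    have cmp: "a2 * M - b2 * m \<le> D_form a1 a2 b1 b2 M m \<and>
       a2 * M - (a2 - a1) * m \<le> D_form a1 a2 b1 b2 M m \<and>
       (b2 - b1) * M - b2 * m \<le> D_form a1 a2 b1 b2 M m \<and>
       D_form a1 a2 b1 b2 M m \<in> {a2 * M - b2 * m, a2 * M - (a2 - a1) * m, (b2 - b1) * M - b2 * m}"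
    proof -
      consider "m \<ge> 0" "M \<ge> 0" | "m \<le> 0" "M \<ge> 0" | "m \<le> 0" "M \<le> 0" using mM by linarith
      then show ?thesis
      proof cases
        case 1
        then have "(b2 - (a2 - a1)) * m \<ge> 0" "(a2 - (b2 - b1)) * M \<ge> 0" using ab by auto
        moreover have "D_form a1 a2 b1 b2 M m = a2 * M - (a2 - a1) * m"
          using 1 by (simp add: D_form_def max_def)
        ultimately show ?thesis by (simp add: algebra_simps)
      next
        case 2
        then have "(b2 - (a2 - a1)) * m \<le> 0" "(a2 - (b2 - b1)) * M \<ge> 0"
          using ab by (auto simp: mult_nonneg_nonpos)
        moreover have "D_form a1 a2 b1 b2 M m = a2 * M - b2 * m"
          using 2 by (simp add: D_form_def max_def)
        ultimately show ?thesis by (simp add: algebra_simps)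
      next
        case 3
        then have "(b2 - (a2 - a1)) * m \<le> 0" "(a2 - (b2 - b1)) * M \<le> 0"
          using ab by (auto simp: mult_nonneg_nonpos)
        moreover have "D_form a1 a2 b1 b2 M m = (b2 - b1) * M - b2 * m"
          using 3 by (simp add: D_form_def max_def)
        ultimately show ?thesis by (simp add: algebra_simps)
      qed
    qed
    have "\<exists>z\<in>P. x \<bullet> z = D_form a1 a2 b1 b2 M m"
    proof -
      have "a2 *\<^sub>R p - b2 *\<^sub>R q \<in> P" "a2 *\<^sub>R p - (a2 - a1) *\<^sub>R q \<in> P" "(b2 - b1) *\<^sub>R p - b2 *\<^sub>R q \<in> P"
        unfolding P_def using p(1) q(1) by blast+
      moreover have "x \<bullet> (s *\<^sub>R p - r *\<^sub>R q) = s * M - r * m" for s r using p q by (simp add: inner_diff_right)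
      ultimately show ?thesis using cmp unfolding insert_iff empty_iff by metis
    qed
    then obtain z where z: "z \<in> P" "x \<bullet> z = D_form a1 a2 b1 b2 M m" by blast
    have "x \<bullet> y \<le> D_form a1 a2 b1 b2 M m" if "y \<in> P" for y
    proof -
      have *: "x \<bullet> (s *\<^sub>R vi - r *\<^sub>R vj) \<le> D_form a1 a2 b1 b2 M m"
        if "vi \<in> V" "vj \<in> V" "s \<ge> 0" "r \<ge> 0" "s * M - r * m \<le> D_form a1 a2 b1 b2 M m" for s r vi vj
        using that mono[of s r "x \<bullet> vi" "x \<bullet> vj"] bd by (simp add: inner_diff_right)
      have 1: "x \<bullet> (a2 *\<^sub>R vi - b2 *\<^sub>R vj) \<le> D_form a1 a2 b1 b2 M m"
        "x \<bullet> (a2 *\<^sub>R vi - (a2 - a1) *\<^sub>R vj) \<le> D_form a1 a2 b1 b2 M m"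
        "x \<bullet> ((b2 - b1) *\<^sub>R vi - b2 *\<^sub>R vj) \<le> D_form a1 a2 b1 b2 M m"
        if "vi \<in> V" "vj \<in> V" for vi vj
        by ((rule *; use that cmp ab in simp)+)
      show ?thesis
        using that 1 unfolding P_def by blast
    qed
    then have "convex hull P \<subseteq> {y. x \<bullet> y \<le> D_form a1 a2 b1 b2 M m}"
      by (intro hull_minimal) (auto simp: convex_halfspace_le)
    then have "support_fun (convex hull P) x = D_form a1 a2 b1 b2 M m"
      by (intro support_fun_eqI[of z]) (use z hull_inc[of z P convex] in auto)
    then show ?thesis using z(1) by (auto simp: D Df finP finite_imp_compact_convex_hull)
  qed
  then show "compact (D_body a1 a2 b1 b2 V)" "convex (D_body a1 a2 b1 b2 V)" "D_body a1 a2 b1 b2 V \<noteq> {}"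
    "support_fun (D_body a1 a2 b1 b2 V) x = D_fun a1 a2 b1 b2 (convex hull (insert 0 V)) x" by auto
qed

section \<open>Simplices as images of faces of the standard simplex\<close>

definition std_face :: "'n::finite set \<Rightarrow> (real^'n) set"
  where "std_face I = {u. (\<forall>i. 0 \<le> u $ i) \<and> (\<Sum>i\<in>UNIV. u $ i) \<le> 1 \<and> (\<forall>i. i \<notin> I \<longrightarrow> u $ i = 0)}"

text \<open>The vertices are the rows with index in \<open>I\<close> of a full square matrix, even
  in lower dimension. Linear images become matrix products, and the rows outside \<open>I\<close>
  stay free for adjusting the determinant.\<close>

definition row_simplex :: "'n set \<Rightarrow> real^'n^'n \<Rightarrow> (real^'n) set"
  where "row_simplex I A = (\<lambda>u. u v* A) ` std_face I"

text \<open>Polymorphic in the entries: the same operation replaces a coordinate of a vector and a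
  row of a matrix, and \<open>vupd_matrix_vector_mult\<close> links the two.\<close>

definition vupd :: "'a^'n \<Rightarrow> 'n \<Rightarrow> 'a \<Rightarrow> 'a^'n"
  where "vupd y j t = (\<chi> k. if k = j then t else y $ k)"

lemma vupd_nth: "vupd y j t $ k = (if k = j then t else y $ k)"
  by (simp add: vupd_def)

lemma vupd_same [simp]: "vupd y j (y $ j) = y"
  by (simp add: vec_eq_iff vupd_nth)

lemma vupd_overwrite [simp]: "vupd (vupd y j s) j t = vupd y j t"
  by (simp add: vec_eq_iff vupd_nth)

lemma vupd_commute: "i \<noteq> j \<Longrightarrow> vupd (vupd y i s) j t = vupd (vupd y j t) i s"
  by (auto simp: vec_eq_iff vupd_nth)

lemma continuous_on_vupd: "continuous_on UNIV (\<lambda>t. vupd (y :: real^'n) i t)"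
  unfolding vupd_def
proof (rule continuous_on_vec_lambda)
  show "continuous_on UNIV (\<lambda>t. if k = i then t else y $ k)" for k by (cases "k = i") auto
qed

lemma vector_matrix_mult_rows: "u v* A = (\<Sum>i\<in>UNIV. u $ i *\<^sub>R A $ i)" for A :: "real^'n^'n"
  by (simp add: vec_eq_iff vector_matrix_mult_def mult.commute)

lemma vector_matrix_mult_axis: "axis i 1 v* A = A $ i" for A :: "real^'n^'n"
proof -
  have "(\<Sum>k\<in>UNIV. axis i 1 $ k *\<^sub>R A $ k) = (\<Sum>k\<in>UNIV. if k = i then A $ k else 0)"
    by (rule sum.cong) (auto simp: axis_def)
  then show ?thesis by (simp add: vector_matrix_mult_rows)
qed

lemma linear_vector_matrix_mult: "linear (\<lambda>u. u v* A)" for A :: "real^'n^'n"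
  using matrix_vector_mul_linear[of "transpose A"] by simp

lemma matrix_vector_mult_nth: "(A *v x) $ i = A $ i \<bullet> x" for A :: "real^'n^'n"
  by (simp add: matrix_vector_mult_def inner_vec_def)

lemma vupd_matrix_vector_mult: "vupd A j w *v x = vupd (A *v x) j (w \<bullet> x)" for A :: "real^'n^'n"
  by (simp add: vec_eq_iff matrix_vector_mult_nth vupd_nth)

lemma std_face_hull:
  fixes I :: "'n::finite set"
  shows "std_face I = convex hull (insert 0 ((\<lambda>i. axis i 1) ` I))"
proof -
  have Basis: "Basis = range (\<lambda>i::'n. axis i (1::real))" by (auto simp: Basis_vec_def)
  have inj: "inj (\<lambda>i::'n. axis i (1::real))" by (auto simp: inj_def axis_eq_axis)
  have "(\<Sum>v\<in>(\<lambda>i. axis i 1) ` I. u \<bullet> v) = (\<Sum>i\<in>I. u $ i)" for u :: "real^'n"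
    by (subst sum.reindex) (use inj in \<open>auto simp: inj_def inj_on_def inner_axis\<close>)
  moreover have "(\<Sum>i\<in>I. u $ i) = (\<Sum>i\<in>UNIV. u $ i)" if "\<forall>i. i \<notin> I \<longrightarrow> u $ i = 0" for u :: "real^'n"
    by (rule sum.mono_neutral_left) (use that in auto)
  moreover have "axis i (1::real) \<in> (\<lambda>i. axis i 1) ` I \<longleftrightarrow> i \<in> I" for i
    using inj by (auto simp: inj_def)
  ultimately show ?thesis
    by (subst substd_simplex) (auto simp: std_face_def Basis inner_axis)
qed

lemma row_simplex_hull: "row_simplex I A = convex hull (insert 0 ((\<lambda>i. A $ i) ` I))"
  unfolding row_simplex_def std_face_hull
  by (simp add: convex_hull_linear_image[OF linear_vector_matrix_mult] image_image vector_matrix_mult_axis)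

lemma row_simplex_cong: "(\<And>i. i \<in> I \<Longrightarrow> A $ i = B $ i) \<Longrightarrow> row_simplex I A = row_simplex I B"
  unfolding row_simplex_hull by (simp cong: image_cong_simp)

lemma row_simplex_matrix_mult: "row_simplex I (A ** Q) = (*v) (transpose Q) ` row_simplex I A"
  unfolding row_simplex_def image_image by (simp add: vector_matrix_mul_assoc)

lemma independent_rows:
  fixes A :: "real^'n^'n"
  assumes "det A \<noteq> 0"
  shows "independent ((\<lambda>i. A $ i) ` I)"
proof -
  have "(\<lambda>i. A $ i) ` I \<subseteq> rows A" by (auto simp: rows_def row_def)
  moreover have "independent (rows A)"
    using det_dependent_rows[of A] assms by (auto simp: dependent_vec_eq)
  ultimately show ?thesis using independent_mono by blast
qed

lemma row_simplex_in_origin_simplices: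
  "det A \<noteq> 0 \<Longrightarrow> row_simplex I A \<in> origin_simplices"
  unfolding origin_simplices_def row_simplex_hull using independent_rows[of A I] by auto

lemma outer_face_row_simplex:
  "det A \<noteq> 0 \<Longrightarrow> outer_face (row_simplex I A) = convex hull ((\<lambda>i. A $ i) ` I)"
  unfolding row_simplex_hull by (rule outer_face_simplex[OF independent_rows])

text \<open>Extend to a basis and list it as rows. If the determinant is negative, swapping two rows
  repairs the sign, and the index set is carried along with the swap.\<close>

lemma independent_as_rows:
  fixes V :: "(real^'n) set"
  assumes "CARD('n) \<ge> 2" "independent V"
  obtains A :: "real^'n^'n" and I where "det A > 0" "V = (\<lambda>i. A $ i) ` I"
proof -
  obtain B where B': "V \<subseteq> B" "B \<subseteq> UNIV" "independent B" "UNIV \<subseteq> span B"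
    by (rule maximal_independent_subset_extend[OF subset_UNIV assms(2)])
  then have B: "V \<subseteq> B" "independent B" "span B = UNIV" by auto
  have "card B = dim (UNIV :: (real^'n) set)" using B dim_eq_card[of B UNIV] by simp
  then have "card B = CARD('n)" by simp
  moreover have "finite B" using B(2) independent_imp_finite by blast
  ultimately obtain f where f: "bij_betw f (UNIV :: 'n set) B"
    using finite_same_card_bij[of "UNIV :: 'n set" B] by auto
  define A where "A = (\<chi> i. f i)"
  have row: "row i A = f i" for i by (simp add: A_def row_def vec_eq_iff)
  have det: "det A \<noteq> 0"
  proof -
    have "\<forall>i. c i = 0" if "(\<Sum>i\<in>UNIV. c i *s row i A) = 0" for c
    proof
      fix i
      define g where "g v = c (inv_into UNIV f v)" for v
      have "(\<Sum>v\<in>B. g v *\<^sub>R v) = (\<Sum>i\<in>UNIV. g (f i) *\<^sub>R f i)"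
        using sum.reindex_bij_betw[OF f, of "\<lambda>v. g v *\<^sub>R v"] by simp
      also have "\<dots> = 0" using that f by (simp add: g_def bij_betw_def row scalar_mult_eq_scaleR)
      finally have "g (f i) = 0"
        using B(2) \<open>finite B\<close> f by (auto simp: independent_explicit bij_betw_def)
      then show "c i = 0" using f by (simp add: g_def bij_betw_def)
    qed
    then have "invertible A"
      unfolding invertible_right_inverse matrix_right_invertible_independent_rows by blast
    then show ?thesis using invertible_det_nz by blast
  qed
  have V: "V = (\<lambda>i. A $ i) ` (f -` V)"
    using B(1) f by (auto simp: A_def bij_betw_def)
  show ?thesis
  proof (cases "det A > 0")
    case True
    then show ?thesis using V that by blast
  next
    case False
    obtain a b :: 'n where ab: "a \<noteq> b"
      using assms(1) by (metis (full_types) UNIV_I card_le_Suc0_iff_eq finite not_less_eq_eq numeral_2_eq_2)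
    let ?p = "Transposition.transpose a b"
    have "det (\<chi> i. A $ ?p i) = - det A"
      using det_permute_rows[of ?p A] by (simp add: permutes_swap_id sign_swap_id ab)
    moreover have "V = (\<lambda>i. (\<chi> i. A $ ?p i) $ i) ` (?p ` (f -` V))"
      using V by (simp add: image_image)
    ultimately show ?thesis using that False det by (metis linorder_neqE_linordered_idom neg_0_less_iff_less)
  qed
qed

lemma origin_simplex_as_row_simplex:
  fixes T :: "(real^'n) set"
  assumes "CARD('n) \<ge> 3" "T \<in> origin_simplices"
  obtains A I where "det A > 0" "T = row_simplex I A"
proof -
  obtain V where V: "independent V" "T = convex hull (insert 0 V)"
    using assms by (auto simp: origin_simplices_def)
  have "CARD('n) \<ge> 2" using assms by simp
  then obtain A :: "real^'n^'n" and I where A: "det A > 0" "V = (\<lambda>i. A $ i) ` I"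
    using independent_as_rows[OF _ V(1)] by blast
  then show ?thesis using that V by (simp add: row_simplex_hull)
qed

section \<open>Cutting a simplex at a point of an edge\<close>

lemma det_vupd_combination:
  fixes A :: "real^'n^'n"
  assumes "i \<noteq> j"
  shows "det (vupd A j (c *\<^sub>R A $ i + d *\<^sub>R A $ j)) = d * det A"
proof -
  have 0: "det (\<chi> k. if k = j then A $ i else A $ k) = 0"
    by (rule det_identical_rows[OF assms]) (use assms in \<open>simp add: row_def\<close>)
  have 1: "(\<chi> k. if k = j then A $ j else A $ k) = A" by (simp add: vec_eq_iff)
  have "det (vupd A j (c *\<^sub>R A $ i + d *\<^sub>R A $ j))
     = det (\<chi> k. if k = j then c *s A $ i + d *s A $ j else A $ k)"
    by (intro arg_cong[of _ _ det]) (simp add: vec_eq_iff vupd_nth)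
  also have "\<dots> = c * det (\<chi> k. if k = j then A $ i else A $ k) + d * det (\<chi> k. if k = j then A $ j else A $ k)"
    unfolding det_row_add[of j "\<lambda>_. c *s A $ i" "\<lambda>_. d *s A $ j" "\<lambda>k. A $ k"]
      det_row_mul[of j c "\<lambda>_. A $ i"] det_row_mul[of j d "\<lambda>_. A $ j"] ..
  finally show ?thesis by (simp add: 0 1)
qed

lemma det_vupd_scale:
  fixes A :: "real^'n^'n"
  shows "det (vupd A j (c *\<^sub>R A $ j)) = c * det A"
proof -
  have 1: "(\<chi> k. if k = j then A $ j else A $ k) = A" by (simp add: vec_eq_iff)
  have "det (vupd A j (c *\<^sub>R A $ j)) = det (\<chi> k. if k = j then c *s A $ j else A $ k)"
    by (intro arg_cong[of _ _ det]) (simp add: vec_eq_iff vupd_nth)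
  also have "\<dots> = c * det (\<chi> k. if k = j then A $ j else A $ k)" by (rule det_row_mul)
  finally show ?thesis by (simp add: 1)
qed

text \<open>Coordinates with respect to \<open>A\<close> of a point with coordinates \<open>u\<close> with respect to the
  basis in which \<open>A $ j\<close> is replaced by \<open>(1 - l) *\<^sub>R A $ i + l *\<^sub>R A $ j\<close>.\<close>
definition split_map :: "real \<Rightarrow> 'n \<Rightarrow> 'n \<Rightarrow> real^'n \<Rightarrow> real^'n"
  where "split_map l i j u = (\<chi> k. if k = i then u $ i + (1 - l) * u $ j else if k = j then l * u $ j else u $ k)"

lemma sum_split_two:
  fixes f :: "'n::finite \<Rightarrow> 'a::ab_group_add"
  assumes "i \<noteq> j"
  shows "(\<Sum>k\<in>UNIV. f k) = f i + f j + (\<Sum>k\<in>UNIV - {i, j}. f k)"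
proof -
  have "(\<Sum>k\<in>UNIV. f k) = (\<Sum>k\<in>{i, j}. f k) + (\<Sum>k\<in>UNIV - {i, j}. f k)"
    by (subst sum.subset_diff[of "{i, j}" UNIV]) (auto simp: add.commute)
  then show ?thesis using assms by simp
qed

lemma vupd_split_map:
  fixes A :: "real^'n^'n"
  assumes "i \<noteq> j"
  shows "u v* vupd A j ((1 - l) *\<^sub>R A $ i + l *\<^sub>R A $ j) = split_map l i j u v* A"
proof -
  let ?w = "(1 - l) *\<^sub>R A $ i + l *\<^sub>R A $ j"
  have "(\<Sum>k\<in>UNIV - {i, j}. u $ k *\<^sub>R vupd A j ?w $ k) = (\<Sum>k\<in>UNIV - {i, j}. split_map l i j u $ k *\<^sub>R A $ k)"
    by (rule sum.cong) (auto simp: vupd_nth split_map_def)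
  moreover have "u $ i *\<^sub>R vupd A j ?w $ i + u $ j *\<^sub>R vupd A j ?w $ j
      = split_map l i j u $ i *\<^sub>R A $ i + split_map l i j u $ j *\<^sub>R A $ j"
    using assms by (simp add: vupd_nth split_map_def algebra_simps)
  ultimately show ?thesis
    unfolding vector_matrix_mult_rows by (subst (1 2) sum_split_two[OF assms]) simp
qed

lemma sum_split_map:
  assumes "i \<noteq> j"
  shows "(\<Sum>k\<in>UNIV. split_map l i j u $ k) = (\<Sum>k\<in>UNIV. u $ k)"
proof -
  have "(\<Sum>k\<in>UNIV - {i, j}. split_map l i j u $ k) = (\<Sum>k\<in>UNIV - {i, j}. u $ k)"
    by (rule sum.cong) (auto simp: split_map_def)
  then show ?thesis
    using assms by (subst (1 2) sum_split_two[OF assms]) (simp add: split_map_def algebra_simps)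
qed

lemma split_map_inverse:
  assumes "i \<noteq> j" "l \<noteq> 0"
  shows "split_map l i j (\<chi> k. if k = i then u $ i - (1 - l) / l * u $ j else if k = j then u $ j / l else u $ k) = u"
  using assms by (auto simp: vec_eq_iff split_map_def)

text \<open>The image has the vertex \<open>(1 - l) e_i + l e_j\<close> in place of
  \<open>e_j\<close>. The inequality is the half-space containing \<open>e_i\<close> whose boundary
  passes through the origin, this new vertex and the remaining vertices.\<close>

lemma split_map_std_face:
  assumes ij: "i \<noteq> j" "i \<in> I" "j \<in> I" and l: "0 < l" "l < 1"
  shows "split_map l i j ` std_face I = {u \<in> std_face I. (1 - l) * u $ j \<le> l * u $ i}"
proof (intro equalityI subsetI)
  fix v assume "v \<in> split_map l i j ` std_face I"
  then obtain u where u: "u \<in> std_face I" "v = split_map l i j u" by auto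
  have "l * u $ i \<ge> 0" using u(1) l by (simp add: std_face_def)
  then have "(1 - l) * v $ j \<le> l * v $ i" using ij l by (simp add: u(2) split_map_def algebra_simps)
  moreover have "0 \<le> v $ k" for k using u(1) l by (auto simp: u(2) split_map_def std_face_def)
  moreover have "k \<notin> I \<Longrightarrow> v $ k = 0" for k using u(1) ij by (auto simp: u(2) split_map_def std_face_def)
  moreover have "(\<Sum>k\<in>UNIV. v $ k) \<le> 1" using u(1) by (simp add: u(2) sum_split_map[OF ij(1)] std_face_def)
  ultimately show "v \<in> {u \<in> std_face I. (1 - l) * u $ j \<le> l * u $ i}" by (simp add: std_face_def)
next
  fix v assume v: "v \<in> {u \<in> std_face I. (1 - l) * u $ j \<le> l * u $ i}"
  define u where "u = (\<chi> k. if k = i then v $ i - (1 - l) / l * v $ j else if k = j then v $ j / l else v $ k)"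
  have vu: "v = split_map l i j u" unfolding u_def using split_map_inverse[OF ij(1), of l v] l by simp
  have "0 \<le> v $ i - (1 - l) / l * v $ j" using v l by (simp add: field_simps)
  then have "0 \<le> u $ k" for k using v l by (auto simp: u_def std_face_def)
  moreover have "k \<notin> I \<Longrightarrow> u $ k = 0" for k using v ij by (auto simp: u_def std_face_def)
  moreover have "(\<Sum>k\<in>UNIV. u $ k) \<le> 1" using v sum_split_map[OF ij(1), of l u] vu by (simp add: std_face_def)
  ultimately have "u \<in> std_face I" by (simp add: std_face_def)
  then show "v \<in> split_map l i j ` std_face I" using vu by blast
qed

lemma split_map_std_face_Int:
  assumes ij: "i \<noteq> j" "i \<in> I" "j \<in> I" and l: "0 < l" "l < 1"
  shows "split_map (1 - l) j i ` std_face (I - {j}) = {u \<in> std_face I. (1 - l) * u $ j = l * u $ i}"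
proof (intro equalityI subsetI)
  fix v assume "v \<in> split_map (1 - l) j i ` std_face (I - {j})"
  then obtain u where u: "u \<in> std_face (I - {j})" "v = split_map (1 - l) j i u" by auto
  have "u $ j = 0" using u(1) by (simp add: std_face_def)
  then have "(1 - l) * v $ j = l * v $ i" using ij l by (simp add: u(2) split_map_def algebra_simps)
  moreover have "0 \<le> v $ k" for k using u(1) l by (auto simp: u(2) split_map_def std_face_def)
  moreover have "k \<notin> I \<Longrightarrow> v $ k = 0" for k using u(1) ij by (auto simp: u(2) split_map_def std_face_def)
  moreover have "(\<Sum>k\<in>UNIV. v $ k) \<le> 1"
    using u(1) by (simp add: u(2) sum_split_map[OF ij(1)[symmetric]] std_face_def)
  ultimately show "v \<in> {u \<in> std_face I. (1 - l) * u $ j = l * u $ i}" by (simp add: std_face_def)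
next
  fix v assume v: "v \<in> {u \<in> std_face I. (1 - l) * u $ j = l * u $ i}"
  define u where "u = (\<chi> k. if k = j then v $ j - (1 - (1 - l)) / (1 - l) * v $ i else if k = i then v $ i / (1 - l) else v $ k)"
  have vu: "v = split_map (1 - l) j i u"
    unfolding u_def using split_map_inverse[OF ij(1)[symmetric], of "1 - l" v] l by simp
  have "v $ j - (1 - (1 - l)) / (1 - l) * v $ i = 0" using v l by (simp add: field_simps)
  then have uj: "u $ j = 0" by (simp add: u_def)
  have "0 \<le> u $ k" for k
    using v l uj by (cases "k = j") (auto simp: u_def std_face_def)
  moreover have "k \<notin> I - {j} \<Longrightarrow> u $ k = 0" for k
    using v ij uj by (cases "k = j") (auto simp: u_def std_face_def)
  moreover have "(\<Sum>k\<in>UNIV. u $ k) \<le> 1"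
    using v sum_split_map[OF ij(1)[symmetric], of "1 - l" u] vu by (simp add: std_face_def)
  ultimately have "u \<in> std_face (I - {j})" by (simp add: std_face_def)
  then show "v \<in> split_map (1 - l) j i ` std_face (I - {j})" using vu by blast
qed

text \<open>Exchanging \<open>i\<close> with \<open>j\<close> and \<open>l\<close> with
  \<open>1 - l\<close> exchanges the two pieces, whose half-spaces are opposite. The common facet
  keeps the cutting point \<open>w\<close> in row \<open>i\<close> and drops row
  \<open>j\<close>.\<close>

lemma row_simplex_split:
  fixes A :: "real^'n^'n"
  assumes A: "det A \<noteq> 0" and ij: "i \<noteq> j" "i \<in> I" "j \<in> I" and l: "0 < l" "l < 1"
  defines "w \<equiv> (1 - l) *\<^sub>R A $ i + l *\<^sub>R A $ j"
  shows "row_simplex I (vupd A j w) \<union> row_simplex I (vupd A i w) = row_simplex I A"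
    and "row_simplex I (vupd A j w) \<inter> row_simplex I (vupd A i w) = row_simplex (I - {j}) (vupd A i w)"
proof -
  have w': "w = (1 - (1 - l)) *\<^sub>R A $ j + (1 - l) *\<^sub>R A $ i" by (simp add: w_def)
  have img: "row_simplex J (vupd A j w) = (\<lambda>u. u v* A) ` (split_map l i j ` std_face J)"
    "row_simplex J (vupd A i w) = (\<lambda>u. u v* A) ` (split_map (1 - l) j i ` std_face J)" for J
    unfolding row_simplex_def image_image
    using vupd_split_map[OF ij(1), of _ A l, folded w_def]
      vupd_split_map[OF ij(1)[symmetric], of _ A "1 - l", folded w'] by simp_all
  have K: "split_map l i j ` std_face I = {u \<in> std_face I. (1 - l) * u $ j \<le> l * u $ i}"
    by (rule split_map_std_face) fact+
  have L: "split_map (1 - l) j i ` std_face I = {u \<in> std_face I. l * u $ i \<le> (1 - l) * u $ j}"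
    using split_map_std_face[of j i I "1 - l"] ij l by simp
  have inj: "inj (\<lambda>u. u v* A)"
  proof -
    have "invertible (transpose A)" using A by (simp add: invertible_det_nz det_transpose)
    from inj_matrix_vector_mult[OF this] show ?thesis by (simp add: inj_def)
  qed
  show "row_simplex I (vupd A j w) \<union> row_simplex I (vupd A i w) = row_simplex I A"
    unfolding img K L image_Un[symmetric] unfolding row_simplex_def by (rule image_cong) auto
  show "row_simplex I (vupd A j w) \<inter> row_simplex I (vupd A i w) = row_simplex (I - {j}) (vupd A i w)"
    unfolding img K L image_Int[OF inj, symmetric] split_map_std_face_Int[OF ij l]
    by (rule image_cong) auto
qed

section \<open>Functional equations\<close>

lemma continuous_zero_at:
  fixes F :: "real \<Rightarrow> real"
  assumes "continuous_on UNIV F" "\<And>t. t \<noteq> a \<Longrightarrow> F t = 0"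
  shows "F a = 0"
proof -
  have "isCont F a" using assms(1) by (simp add: continuous_on_eq_continuous_at)
  then have "(F \<longlongrightarrow> F a) (at a)" by (simp add: isCont_def)
  moreover have "(F \<longlongrightarrow> 0) (at a)"
    by (rule tendsto_eventually) (use assms(2) in \<open>auto simp: eventually_at_filter\<close>)
  ultimately show ?thesis using tendsto_unique trivial_limit_at by blast
qed

lemma eq_if_agree_on:
  fixes F :: "real^'n \<Rightarrow> real"
  assumes dep: "\<And>y k t. k \<notin> I \<Longrightarrow> F (vupd y k t) = F y"
    and agree: "\<And>i. i \<in> I \<Longrightarrow> y $ i = y' $ i"
  shows "F y = F y'"
proof -
  have "F (\<chi> k. if k \<in> J then y' $ k else y $ k) = F y" if "finite J" "J \<subseteq> - I" for J
    using that
  proof (induction J)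
    case (insert j J)
    have "(\<chi> k. if k \<in> insert j J then y' $ k else y $ k)
        = vupd (\<chi> k. if k \<in> J then y' $ k else y $ k) j (y' $ j)"
      by (auto simp: vec_eq_iff vupd_nth)
    then show ?case using insert dep by simp
  qed simp
  from this[of "- I"] have "F (\<chi> k. if k \<in> - I then y' $ k else y $ k) = F y" by simp
  moreover have "(\<chi> k. if k \<in> - I then y' $ k else y $ k) = y'" using agree by (simp add: vec_eq_iff)
  ultimately show ?thesis by simp
qed

text \<open>The functional equation is used with one of the three values \<open>y $ i\<close>, \<open>y $ j\<close>, \<open>0\<close> lying
  between the other two, which expresses \<open>F s y\<close> through points with fewer nonzero coordinates.\<close>
lemma functional_equation_unique:
  fixes F :: "real \<Rightarrow> real^'n \<Rightarrow> real"
  assumes cont: "\<And>s. s > 0 \<Longrightarrow> continuous_on UNIV (F s)"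
    and dep: "\<And>s y k t. s > 0 \<Longrightarrow> k \<notin> I \<Longrightarrow> F s (vupd y k t) = F s y"
    and rel: "\<And>s y i j l w. s > 0 \<Longrightarrow> i \<in> I \<Longrightarrow> j \<in> I \<Longrightarrow> i \<noteq> j \<Longrightarrow> 0 < l \<Longrightarrow> l < 1 \<Longrightarrow>
        w = (1 - l) * y $ i + l * y $ j \<Longrightarrow>
        F s y = F (l * s) (vupd y j w) + F ((1 - l) * s) (vupd y i w)"
    and base: "\<And>s i t. s > 0 \<Longrightarrow> i \<in> I \<Longrightarrow> F s (axis i t) = 0"
    and zero: "\<And>s. s > 0 \<Longrightarrow> F s 0 = 0"
    and s: "s > 0"
  shows "F s y = 0"
  using s
proof (induction "card {i \<in> I. y $ i \<noteq> 0}" arbitrary: s y rule: less_induct)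
  case (less y s)
  let ?N = "\<lambda>y::real^'n. {i \<in> I. y $ i \<noteq> 0}"
  show ?case
  proof (cases "\<exists>i\<in>?N y. \<exists>j\<in>?N y. i \<noteq> j")
    case False
    then consider "?N y = {}" | i where "?N y = {i}" by blast
    then show ?thesis
    proof cases
      case 1
      have "F s y = F s 0"
        by (rule eq_if_agree_on[of I "F s", OF dep[OF less.prems]]) (use 1 in auto)
      then show ?thesis using zero less.prems by simp
    next
      case 2
      have "F s y = F s (axis i (y $ i))"
        by (rule eq_if_agree_on[of I "F s", OF dep[OF less.prems]]) (use 2 in \<open>auto simp: axis_def\<close>)
      then show ?thesis using base[of s i] 2 less.prems by auto
    qed
  next
    case True
    then obtain i j where ij: "i \<in> I" "j \<in> I" "i \<noteq> j" "y $ i \<noteq> 0" "y $ j \<noteq> 0" by auto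
    have IH: "F s' z = 0" if "s' > 0" "?N z \<subset> ?N y" for s' z
      using less.hyps[of z s'] that psubset_card_mono[of "?N y" "?N z"] by auto
    have distinct: "F s' z = 0" if "s' > 0" "?N z = ?N y" "z $ i \<noteq> z $ j" for s' z
    proof -
      define p where "p = z $ i" define q where "q = z $ j"
      have pq: "p \<noteq> 0" "q \<noteq> 0" "p \<noteq> q" using that ij by (auto simp: p_def q_def)
      have N0: "F r (vupd z i 0) = 0" "F r (vupd z j 0) = 0"
        "F r (vupd (vupd z i 0) j q') = 0" "F r (vupd (vupd z j 0) i q') = 0" if "r > 0" "q' \<noteq> 0" for r q'
        by (rule IH; use that ij \<open>?N z = ?N y\<close> in \<open>auto simp: vupd_nth split: if_splits\<close>)+
      have zi: "vupd z i p = z" "vupd z j q = z" by (simp_all add: p_def q_def)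
      have cases: "p * q < 0 \<or> (0 < p / q \<and> p / q < 1) \<or> (0 < q / p \<and> q / p < 1)"
        using pq by (cases "p > 0"; cases "q > 0") (auto simp: field_simps mult_less_0_iff)
      then show ?thesis
      proof (elim disjE)
        assume neg: "p * q < 0"
        \<comment> \<open>Opposite signs: 0 lies between \<open>p\<close> and \<open>q\<close>, and
          this weight makes the cut value 0. Both new points then have one nonzero coordinate
          fewer.\<close>
        define l where "l = p / (p - q)"
        have l: "0 < l" "l < 1" using neg unfolding l_def mult_less_0_iff by (auto simp: field_simps)
        have "0 = (1 - l) * z $ i + l * z $ j"
          using pq unfolding p_def[symmetric] q_def[symmetric] l_def by (simp add: field_simps)
        from rel[OF \<open>s' > 0\<close> ij(1-3) l this] show ?thesis using N0(1,2)[of _ 1] l \<open>s' > 0\<close> by simp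
      next
        assume "0 < p / q \<and> p / q < 1"
        then have l: "0 < p / q" "p / q < 1" by auto
        \<comment> \<open>Here \<open>p\<close> lies between 0 and \<open>q\<close>, so the equation
          is applied to the point with coordinates \<open>0, q\<close>, cut at the value
          \<open>p\<close>. One piece is \<open>z\<close> itself, the other two points have fewer
          nonzero coordinates; the starting volume \<open>s' / (1 - l)\<close> gives the piece
          \<open>z\<close> the volume \<open>s'\<close>.\<close>
        define l where "l = p / q"
        have w: "p = (1 - l) * vupd z i 0 $ i + l * vupd z i 0 $ j"
          using pq ij by (simp add: vupd_nth l_def q_def)
        note l = l[folded l_def]
        have r: "s' / (1 - l) > 0" "l * (s' / (1 - l)) > 0" "(1 - l) * (s' / (1 - l)) = s'"
          using l \<open>s' > 0\<close> by simp_all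
        from rel[OF r(1) ij(1-3) l w] show ?thesis
          unfolding r(3) using N0(1)[OF r(1), of 1] N0(3)[OF r(2) pq(1)] by (simp add: zi)
      next
        assume "0 < q / p \<and> q / p < 1"
        then have l: "0 < 1 - q / p" "1 - q / p < 1" by auto
        define l where "l = 1 - q / p"
        have w: "q = (1 - l) * vupd z j 0 $ i + l * vupd z j 0 $ j"
          using pq ij by (simp add: vupd_nth l_def p_def)
        note l = l[folded l_def]
        have r: "s' / l > 0" "(1 - l) * (s' / l) > 0" "l * (s' / l) = s'"
          using l \<open>s' > 0\<close> by simp_all
        from rel[OF r(1) ij(1-3) l w] show ?thesis
          unfolding r(3) using N0(2)[OF r(1), of 1] N0(4)[OF r(2) pq(2)] by (simp add: zi)
      qed
    qed
    show ?thesis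
    proof (cases "y $ i = y $ j")
      case True
      \<comment> \<open>Equal coordinates leave no room for a cut between them, so this value is the
        limit of those with \<open>y $ i\<close> perturbed.\<close>
      have "F s (vupd y i (y $ i)) = 0"
      proof (rule continuous_zero_at[of "\<lambda>t. F s (vupd y i t)" "y $ i"])
        show "continuous_on UNIV (\<lambda>t. F s (vupd y i t))"
          by (rule continuous_on_compose2[OF cont[OF less.prems] continuous_on_vupd]) simp
        fix t assume t: "t \<noteq> y $ i"
        show "F s (vupd y i t) = 0"
        proof (cases "t = 0")
          case True
          then show ?thesis by (intro IH less.prems) (use ij in \<open>auto simp: vupd_nth\<close>)
        next
          case False
          then show ?thesis
            by (intro distinct less.prems) (use ij t True in \<open>auto simp: vupd_nth\<close>)
        qed
      qed
      then show ?thesis by simp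
    qed (use distinct less.prems in blast)
  qed
qed

text \<open>A negative value would fall below any bound after multiplication by a large integer. So
  \<open>f\<close> is nonnegative, hence monotone, and a monotone solution of Cauchy's equation is
  linear.\<close>

lemma additive_bounded_below_linear:
  fixes f :: "real \<Rightarrow> real"
  assumes add: "\<And>s t. s > 0 \<Longrightarrow> t > 0 \<Longrightarrow> f (s + t) = f s + f t"
    and bdd: "\<And>s. s > 0 \<Longrightarrow> f s \<ge> - C"
    and s: "s > 0"
  shows "f s = s * f 1" and "f s \<ge> 0"
proof -
  have mult: "f (real (Suc n) * s) = real (Suc n) * f s" if "s > 0" for n s
  proof (induction n)
    case (Suc n)
    have "f (real (Suc (Suc n)) * s) = f (s + real (Suc n) * s)" by (simp add: algebra_simps)
    also have "\<dots> = f s + real (Suc n) * f s" using add[of s "real (Suc n) * s"] Suc that by simp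
    finally show ?case by (simp add: algebra_simps)
  qed simp
  have nonneg: "f s \<ge> 0" if "s > 0" for s
  proof (rule ccontr)
    assume "\<not> f s \<ge> 0"
    then obtain n where "C < real n * - f s" using reals_Archimedean3[of "- f s"] by auto
    moreover have "real (Suc n) * f s \<ge> - C"
      unfolding mult[OF that, symmetric] by (rule bdd) (use that in simp)
    ultimately show False using \<open>\<not> f s \<ge> 0\<close> by (simp add: algebra_simps)
  qed
  then show "f s \<ge> 0" using s .
  have mono: "f a \<le> f b" if "0 < a" "a \<le> b" for a b
  proof (cases "a = b")
    case False
    then show ?thesis using add[of a "b - a"] nonneg[of "b - a"] that by simp
  qed simp
  have f1: "f 1 \<ge> 0" using nonneg by simp
  \<comment> \<open>With \<open>k\<close> the integer part of \<open>n * s\<close>, both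
    \<open>f (n * s)\<close> and \<open>n * s * f 1\<close> lie between \<open>k * f 1\<close> and
    \<open>(k + 1) * f 1\<close>.\<close>
  have est: "real n * \<bar>f s - s * f 1\<bar> \<le> f 1" if "real n * s \<ge> 1" for n
  proof -
    define k where "k = nat \<lfloor>real n * s\<rfloor>"
    have k: "1 \<le> k" "real k \<le> real n * s" "real n * s < real k + 1"
      using that by (auto simp: k_def le_nat_iff le_floor_iff)
    have n: "n \<noteq> 0" using that by (cases n) auto
    have fn: "f (real n * s) = real n * f s" using mult[OF s, of "n - 1"] n by simp
    have fk: "f (real m) = real m * f 1" if "m \<ge> 1" for m using mult[of 1 "m - 1"] that by simp
    have "real k * f 1 \<le> real n * f s"
      using mono[of "real k" "real n * s"] k fk[of k] fn by simp
    moreover have "real n * f s \<le> (real k + 1) * f 1"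
      using mono[of "real n * s" "real (Suc k)"] k fk[of "Suc k"] fn that by (simp add: add.commute)
    moreover have "real k * f 1 \<le> real n * s * f 1" "real n * s * f 1 \<le> (real k + 1) * f 1"
      using k f1 by (auto intro!: mult_right_mono)
    ultimately have "\<bar>real n * f s - real n * s * f 1\<bar> \<le> f 1" by (simp add: abs_le_iff algebra_simps)
    also have "real n * f s - real n * s * f 1 = real n * (f s - s * f 1)" by (simp add: algebra_simps)
    finally show ?thesis by (simp add: abs_mult)
  qed
  show "f s = s * f 1"
  proof (rule ccontr)
    assume ne: "f s \<noteq> s * f 1"
    then obtain n1 where n1: "f 1 < real n1 * \<bar>f s - s * f 1\<bar>"
      using reals_Archimedean3[of "\<bar>f s - s * f 1\<bar>"] by auto
    obtain n2 where n2: "1 < real n2 * s" using reals_Archimedean3[OF s] by auto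
    define n where "n = max n1 n2"
    have "real n2 * s \<le> real n * s" "real n1 * \<bar>f s - s * f 1\<bar> \<le> real n * \<bar>f s - s * f 1\<bar>"
      using s by (auto simp: n_def intro!: mult_right_mono)
    then show False using est[of n] n1 n2 by simp
  qed
qed

section \<open>Real-valued SL(n) covariant valuations\<close>

text \<open>A representative matrix for each determinant \<open>s\<close>; the index
  \<open>undefined\<close> stands for an arbitrary fixed position.\<close>

definition diag_mat :: "real \<Rightarrow> real^'n^'n"
  where "diag_mat s = (\<chi> i j. if i = j then (if i = undefined then s else 1) else 0)"

lemma det_diag_mat: "det (diag_mat s :: real^'n^'n) = s"
proof -
  have "det (diag_mat s :: real^'n^'n) = (\<Prod>i\<in>(UNIV :: 'n set). if i = undefined then s else 1)"
    by (subst det_diagonal) (auto simp: diag_mat_def)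
  then show ?thesis by simp
qed

lemma diag_mat_inverse:
  assumes "s \<noteq> 0"
  shows "diag_mat s ** diag_mat (1 / s) = (mat 1 :: real^'n^'n)"
proof -
  have "(\<Sum>k\<in>UNIV. (if i = k then (if i = undefined then s else 1) else 0) *
      (if k = j then (if k = undefined then 1 / s else 1) else 0)) = (if i = j then 1 else 0)" for i j :: 'n
  proof -
    have "(\<Sum>k\<in>UNIV. (if i = k then (if i = undefined then s else 1) else 0) *
      (if k = j then (if k = undefined then 1 / s else 1) else 0))
      = (\<Sum>k\<in>UNIV. if k = i then (if i = j then 1 else 0) else (0::real))"
      by (rule sum.cong) (use assms in auto)
    then show ?thesis by simp
  qed
  then show ?thesis by (simp add: vec_eq_iff diag_mat_def matrix_matrix_mult_def mat_def)
qed

lemma solve_matrix: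
  assumes "det A \<noteq> (0::real)"
  obtains x where "A *v x = y"
proof -
  obtain B where "A ** B = mat 1" using assms invertible_det_nz invertible_def by blast
  then have "A *v (B *v y) = y" by (simp add: matrix_vector_mul_assoc)
  then show ?thesis using that by blast
qed

text \<open>All conditions are linear in \<open>h\<close>, so they survive the subtractions in
  \<open>SL_valuation_diff\<close>.\<close>

locale SL_valuation =
  fixes h :: "(real^'n) set \<Rightarrow> real^'n \<Rightarrow> real"
  assumes card3: "CARD('n) \<ge> 3"
    and covariant: "det Q = 1 \<Longrightarrow> T \<in> origin_simplices \<Longrightarrow> h ((*v) Q ` T) x = h T (transpose Q *v x)"
    and valuation: "K \<in> origin_simplices \<Longrightarrow> L \<in> origin_simplices \<Longrightarrow> K \<union> L \<in> origin_simplices \<Longrightarrow>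
      K \<inter> L \<in> origin_simplices \<Longrightarrow> h (K \<union> L) x + h (K \<inter> L) x = h K x + h L x"
    and continuous: "T \<in> origin_simplices \<Longrightarrow> continuous_on UNIV (h T)"
    and homogeneous: "T \<in> origin_simplices \<Longrightarrow> c \<ge> 0 \<Longrightarrow> h T (c *\<^sub>R x) = c * h T x"
begin

text \<open>By \<open>SL(n)\<close> covariance, the value of \<open>h\<close> on a simplex with an ordered vertex matrix \<open>A\<close> depends
  only on \<open>det A\<close> and \<open>A *v x\<close>; the lower-dimensional simplices use only the rows in \<open>I\<close>.\<close>
definition H :: "real \<Rightarrow> 'n set \<Rightarrow> real^'n \<Rightarrow> real"
  where "H s I y = h (row_simplex I (diag_mat s)) (diag_mat (1 / s) *v y)"

text \<open>\<open>A\<close> is \<open>diag_mat s\<close> times a matrix \<open>Q\<close> of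
  determinant 1, and right multiplication by \<open>Q\<close> is a linear image of the simplex, so
  covariance applies.\<close>

lemma h_row_simplex:
  assumes "det A = s" "s > 0"
  shows "h (row_simplex I A) x = H s I (A *v x)"
proof -
  define Q where "Q = diag_mat (1 / s) ** A"
  have "det Q = 1" using assms by (simp add: Q_def det_mul det_diag_mat)
  have "diag_mat s ** diag_mat (1 / s) = (mat 1 :: real^'n^'n)"
    using assms(2) by (intro diag_mat_inverse) simp
  then have A: "A = diag_mat s ** Q" by (simp add: Q_def matrix_mul_assoc)
  have "h (row_simplex I A) x = h ((*v) (transpose Q) ` row_simplex I (diag_mat s)) x"
    unfolding A row_simplex_matrix_mult ..
  also have "\<dots> = h (row_simplex I (diag_mat s)) (transpose (transpose Q) *v x)"
    by (rule covariant)
       (use assms \<open>det Q = 1\<close> in \<open>auto simp: det_transpose det_diag_mat intro!: row_simplex_in_origin_simplices\<close>)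
  also have "transpose (transpose Q) *v x = diag_mat (1 / s) *v (A *v x)"
    unfolding transpose_transpose by (simp add: Q_def matrix_vector_mul_assoc)
  finally show ?thesis by (simp add: H_def)
qed

lemma diag_simplex: "s > 0 \<Longrightarrow> row_simplex I (diag_mat s) \<in> origin_simplices"
  by (rule row_simplex_in_origin_simplices) (simp add: det_diag_mat)

lemma continuous_on_H:
  assumes "s > 0"
  shows "continuous_on UNIV (H s I)"
  unfolding H_def
  by (rule continuous_on_compose2[OF continuous[OF diag_simplex[OF assms]]])
     (auto intro: matrix_vector_mult_linear_continuous_on)

lemma H_homogeneous: "s > 0 \<Longrightarrow> c \<ge> 0 \<Longrightarrow> H s I (c *\<^sub>R y) = c * H s I y"
  unfolding H_def by (simp add: homogeneous diag_simplex matrix_vector_mult_scaleR)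

lemma H_zero: "s > 0 \<Longrightarrow> H s I 0 = 0"
  using H_homogeneous[of s 0 I 0] by simp

lemma H_axis:
  assumes "s > 0" "H s I (axis i 1) = 0" "H s I (axis i (-1)) = 0"
  shows "H s I (axis i t) = 0"
proof (cases "t \<ge> 0")
  case True
  have "axis i t = t *\<^sub>R axis i (1::real)" by (simp add: vec_eq_iff axis_def)
  then show ?thesis using H_homogeneous[OF assms(1) True] assms(2) by simp
next
  case False
  have "axis i t = (- t) *\<^sub>R axis i (-1::real)" by (simp add: vec_eq_iff axis_def)
  then show ?thesis using H_homogeneous[of s "- t"] False assms by simp
qed

text \<open>The functional equation. The determinants of the two pieces are \<open>l * s\<close> and
  \<open>(1 - l) * s\<close>; the common face is read off from the matrix of the second piece, which
  explains its volume \<open>(1 - l) * s\<close>.\<close>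

lemma H_valuation:
  assumes s: "s > 0" and ij: "i \<in> I" "j \<in> I" "i \<noteq> j" and l: "0 < l" "l < 1"
    and w: "w = (1 - l) * y $ i + l * y $ j"
  shows "H s I y + H ((1 - l) * s) (I - {j}) (vupd y i w)
    = H (l * s) I (vupd y j w) + H ((1 - l) * s) I (vupd y i w)"
proof -
  define A :: "real^'n^'n" where "A = diag_mat s"
  have dA: "det A = s" by (simp add: A_def det_diag_mat)
  obtain x where x: "A *v x = y" using solve_matrix[of A y] dA s by auto
  define v where "v = (1 - l) *\<^sub>R A $ i + l *\<^sub>R A $ j"
  have v: "v \<bullet> x = w"
    using x[symmetric] by (simp add: v_def w inner_add_left matrix_vector_mult_nth)
  have dj: "det (vupd A j v) = l * s" unfolding v_def det_vupd_combination[OF ij(3)] dA ..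
  have di: "det (vupd A i v) = (1 - l) * s"
    using det_vupd_combination[OF ij(3)[symmetric], of A l "1 - l"] by (simp add: v_def dA add.commute)
  have pos: "l * s > 0" "(1 - l) * s > 0" using s l by auto
  note sp = row_simplex_split[OF _ ij(3,1,2) l, of A, folded v_def]
  have nz: "det A \<noteq> 0" "det (vupd A j v) \<noteq> 0" "det (vupd A i v) \<noteq> 0"
    unfolding dA di dj using s pos by linarith+
  note mem = row_simplex_in_origin_simplices[OF nz(1), of I] row_simplex_in_origin_simplices[OF nz(2), of I]
    row_simplex_in_origin_simplices[OF nz(3)]
  have "h (row_simplex I A) x + h (row_simplex (I - {j}) (vupd A i v)) x
      = h (row_simplex I (vupd A j v)) x + h (row_simplex I (vupd A i v)) x"
    using valuation[of "row_simplex I (vupd A j v)" "row_simplex I (vupd A i v)" x] mem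
    unfolding sp[OF nz(1)] by blast
  then show ?thesis
    unfolding h_row_simplex[OF dA s] h_row_simplex[OF dj pos(1)] h_row_simplex[OF di pos(2)]
      vupd_matrix_vector_mult x v .
qed

text \<open>The form in which dimension at least three is used: it provides proper index sets of
  size two, a pair of zero coordinates besides \<open>i\<close>, and an even permutation moving
  \<open>i\<close> to \<open>j\<close>.\<close>

lemma other_index: obtains k :: 'n where "k \<noteq> i" "k \<noteq> j"
proof -
  have "card {i, j} < CARD('n)" using card3 by (auto simp: card_insert_if)
  then have "{i, j} \<noteq> UNIV" by auto
  then show ?thesis using that by auto
qed

text \<open>Row \<open>k\<close> is not a vertex, so adding to it a multiple of another row changes
  neither simplex nor determinant. If some other coordinate of \<open>y\<close> is nonzero, such a
  shear moves \<open>y $ k\<close> to any value.\<close>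

lemma H_independent:
  assumes s: "s > 0" and k: "k \<notin> I"
  shows "H s I (vupd y k t) = H s I y"
proof -
  have gen: "H s I (vupd y k t) = H s I y" if "i \<noteq> k" "y $ i \<noteq> 0" for y i t
  proof -
    define A :: "real^'n^'n" where "A = diag_mat s"
    have dA: "det A = s" by (simp add: A_def det_diag_mat)
    obtain x where x: "A *v x = y" using solve_matrix[of A y] dA s by auto
    define c where "c = (t - y $ k) / y $ i"
    define B where "B = vupd A k (c *\<^sub>R A $ i + 1 *\<^sub>R A $ k)"
    have dB: "det B = s" unfolding B_def det_vupd_combination[OF that(1)] by (simp add: dA)
    have "row_simplex I A = row_simplex I B"
      by (rule row_simplex_cong) (use k in \<open>auto simp: B_def vupd_nth\<close>)
    then have "H s I (A *v x) = H s I (B *v x)"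
      using h_row_simplex[OF dA s] h_row_simplex[OF dB s] by metis
    moreover have "(c *\<^sub>R A $ i + 1 *\<^sub>R A $ k) \<bullet> x = t"
      using x[symmetric] that by (simp add: inner_add_left matrix_vector_mult_nth[symmetric] c_def)
    ultimately show ?thesis by (simp only: B_def vupd_matrix_vector_mult x)
  qed
  show ?thesis
  proof (cases "\<exists>i. i \<noteq> k \<and> y $ i \<noteq> 0")
    case True
    then show ?thesis using gen by blast
  next
    case False
    obtain i where i: "i \<noteq> k" using other_index by blast
    \<comment> \<open>All coordinates other than \<open>k\<close> vanish, so a shear cannot act;
      coordinate \<open>i\<close> is perturbed to \<open>e\<close> and \<open>e\<close> tends to
      0.\<close>
    have "H s I (vupd (vupd y i 0) k t) - H s I (vupd y i 0) = 0"
    proof (rule continuous_zero_at[of "\<lambda>e. H s I (vupd (vupd y i e) k t) - H s I (vupd y i e)" 0])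
      have "continuous_on UNIV (\<lambda>e. H s I (vupd (vupd y k t) i e) - H s I (vupd y i e))"
        by (intro continuous_intros continuous_on_compose2[OF continuous_on_H[OF s] continuous_on_vupd]) simp_all
      then show "continuous_on UNIV (\<lambda>e. H s I (vupd (vupd y i e) k t) - H s I (vupd y i e))"
        by (simp add: vupd_commute[OF i])
      show "H s I (vupd (vupd y i e) k t) - H s I (vupd y i e) = 0" if "e \<noteq> 0" for e
        using gen[OF i, of "vupd y i e" t] that by (simp add: vupd_nth)
    qed
    moreover have "vupd y i 0 = y" using False i by (auto simp: vec_eq_iff vupd_nth)
    ultimately show ?thesis by simp
  qed
qed

text \<open>The free row \<open>k\<close> can be rescaled to bring the determinant to any
  \<open>s\<close>, correcting its sign as well. Since \<open>s\<close> is arbitrary,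
  \<open>H_lower\<close> follows.\<close>

lemma H_scale:
  assumes s: "s > 0" and k: "k \<notin> I" and A: "det A \<noteq> 0"
  shows "h (row_simplex I A) x = H s I (A *v x)"
proof -
  define B where "B = vupd A k ((s / det A) *\<^sub>R A $ k)"
  have dB: "det B = s" unfolding B_def det_vupd_scale using A by simp
  have "row_simplex I A = row_simplex I B"
    by (rule row_simplex_cong) (use k in \<open>auto simp: B_def vupd_nth\<close>)
  then show ?thesis
    using h_row_simplex[OF dB s] by (simp add: B_def vupd_matrix_vector_mult H_independent[OF s k])
qed

lemma H_lower:
  assumes "s > 0" "r > 0" "k \<notin> I"
  shows "H s I y = H r I y"
proof -
  obtain x where "(diag_mat s :: real^'n^'n) *v x = y"
    using solve_matrix[of "diag_mat s" y] assms by (auto simp: det_diag_mat)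
  then show ?thesis
    using H_scale[of s k I "diag_mat s" x] H_scale[of r k I "diag_mat s" x] assms
    by (simp add: det_diag_mat)
qed

text \<open>Reordering the vertices changes only the matrix. An odd reordering reverses orientation,
  which a row outside \<open>I\<close> can repair by \<open>H_scale\<close>.\<close>

lemma H_permute:
  assumes s: "s > 0" and p: "p permutes UNIV" and sgn: "sign p = 1 \<or> I \<noteq> UNIV"
  shows "H s (p ` I) (axis (p i) t) = H s I (axis i t)"
proof -
  define A :: "real^'n^'n" where "A = diag_mat s"
  have dA: "det A = s" by (simp add: A_def det_diag_mat)
  obtain x where x: "A *v x = axis (p i) t" using solve_matrix[of A "axis (p i) t"] dA s by auto
  define B where "B = (\<chi> i. A $ p i)"
  have dB: "det B = of_int (sign p) * s" unfolding B_def det_permute_rows[OF p] dA ..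
  have Bx: "B *v x = axis i t"
  proof -
    have "(B *v x) $ k = (A *v x) $ p k" for k by (simp add: B_def matrix_vector_mult_nth)
    then show ?thesis
      using permutes_inj[OF p] by (auto simp: vec_eq_iff x axis_def inj_def)
  qed
  have "row_simplex (p ` I) A = row_simplex I B"
    unfolding row_simplex_hull by (simp add: B_def image_image)
  then have 1: "h (row_simplex I B) x = H s (p ` I) (axis (p i) t)"
    using h_row_simplex[OF dA s, of "p ` I" x] x by simp
  show ?thesis
  proof (cases "sign p = 1")
    case True
    then show ?thesis using 1 h_row_simplex[of B s I x] dB s Bx by simp
  next
    case False
    then obtain k where k: "k \<notin> I" using sgn by blast
    have "det B \<noteq> 0" using dB s by (simp add: sign_nz)
    from H_scale[OF s k this, of x] show ?thesis using 1 Bx by simp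
  qed
qed

text \<open>By induction on the dimension the common face of a cut contributes 0, so
  \<open>functional_equation_unique\<close> applies and only the points \<open>axis i t\<close>
  remain. Those reduce to the segment and the triangle of the hypotheses.\<close>

lemma H_lower_zero:
  fixes i0 j0 :: 'n
  assumes ij0: "i0 \<noteq> j0"
    and one: "H 1 {i0} (axis i0 1) = 0" "H 1 {i0} (axis i0 (-1)) = 0"
    and two: "H 1 {i0, j0} (axis i0 1) = 0" "H 1 {i0, j0} (axis i0 (-1)) = 0"
    and "I \<noteq> UNIV" "s > 0"
  shows "H s I y = 0"
  using assms(6,7)
proof (induction "card I" arbitrary: I s y rule: less_induct)
  case less
  obtain k where k: "k \<notin> I" using less.prems by blast
  have IH: "H s' J y' = 0" if "J \<subset> I" "s' > 0" for s' J y'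
    using less.hyps[of J s' y'] that less.prems psubset_card_mono[of I J] by auto
  show ?case
  proof (rule functional_equation_unique[of "\<lambda>s. H s I" I])
    show "H s I y = H (l * s) I (vupd y j w) + H ((1 - l) * s) I (vupd y i w)"
      if "s > 0" "i \<in> I" "j \<in> I" "i \<noteq> j" "0 < l" "l < 1" "w = (1 - l) * y $ i + l * y $ j" for s y i j l w
    proof -
      have "I - {j} \<subset> I" "(1 - l) * s > 0" using that by auto
      from H_valuation[OF that] IH[OF this] show ?thesis by simp
    qed
    show "H s I (axis i t) = 0" if "s > 0" "i \<in> I" for s i t
    proof -
      have "H 1 I (axis i t) = 0"
      proof (cases "\<exists>a b. a \<in> I \<and> b \<in> I \<and> a \<noteq> b \<and> a \<noteq> i \<and> b \<noteq> i")
        case True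
        then obtain a b where ab: "a \<in> I" "b \<in> I" "a \<noteq> b" "a \<noteq> i" "b \<noteq> i" by blast
        have 0: "axis i t $ a = 0" "axis i t $ b = 0" using ab by (auto simp: axis_def)
        have v: "vupd (axis i t) a 0 = axis i t" "vupd (axis i t) b 0 = axis i t"
          using vupd_same[of "axis i t" a] vupd_same[of "axis i t" b] 0 by simp_all
        \<comment> \<open>Halving the edge between two zero coordinates leaves the argument
          unchanged. As the volume is immaterial below full dimension, the value equals twice
          itself.\<close>
        have "H 1 I (axis i t) + H (1/2) (I - {b}) (axis i t) = H (1/2) I (axis i t) + H (1/2) I (axis i t)"
          using H_valuation[of 1 a I b "1/2" 0 "axis i t"] ab by (simp add: 0 v)
        moreover have "H (1/2) (I - {b}) (axis i t) = 0" by (rule IH) (use ab in auto)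
        ultimately show ?thesis using H_lower[of "1/2" 1 k I "axis i t"] k by simp
      next
        case False
        have "I = {i} \<or> (\<exists>j. j \<noteq> i \<and> I = {i, j})"
        proof (cases "I = {i}")
          case nsing: False
          then obtain j where j: "j \<in> I" "j \<noteq> i" using \<open>i \<in> I\<close> by auto
          have "x \<in> {i, j}" if "x \<in> I" for x using False j that by auto
          then have "I = {i, j}" using j \<open>i \<in> I\<close> by auto
          then show ?thesis using j by blast
        qed simp
        then consider "I = {i}" | j where "j \<noteq> i" "I = {i, j}" by auto
        then have "H 1 I (axis i 1) = 0 \<and> H 1 I (axis i (-1)) = 0"
        proof cases
          case 1
          let ?p = "Transposition.transpose i0 i"
          have p: "?p permutes UNIV" by (simp add: permutes_swap_id)
          obtain m where "m \<noteq> i0" using other_index by blast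
          then have "{i0} \<noteq> UNIV" by auto
          then show ?thesis
            using H_permute[of 1 ?p "{i0}" i0 1] H_permute[of 1 ?p "{i0}" i0 "-1"] p one 1 by simp
        next
          case 2
          let ?q = "Transposition.transpose i0 i"
          let ?p = "Transposition.transpose (?q j0) j \<circ> ?q"
          have p: "?p permutes UNIV" by (intro permutes_compose permutes_swap_id) auto
          have "?q j0 \<noteq> i" using ij0 by (auto simp: Transposition.transpose_def)
          then have pi: "?p i0 = i" "?p j0 = j" using 2(1) by simp_all
          obtain m where "m \<noteq> i0" "m \<noteq> j0" using other_index by blast
          then have "{i0, j0} \<noteq> UNIV" by auto
          moreover have "?p ` {i0, j0} = I" using pi 2 by simp
          ultimately show ?thesis
            using H_permute[of 1 ?p "{i0, j0}" i0 1] H_permute[of 1 ?p "{i0, j0}" i0 "-1"] p two pi by simp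
        qed
        then show ?thesis using H_axis[of 1 I i t] by simp
      qed
      then show ?thesis using H_lower[OF that(1) _ k, of 1] by simp
    qed
  qed (use less.prems continuous_on_H H_independent H_zero in auto)
qed

text \<open>Cutting an edge whose endpoints both have coordinate 0 does not move
  \<open>axis i t\<close> but splits the volume in any ratio, and the common face contributes
  nothing. Hence the value is additive in \<open>s\<close>.\<close>

lemma H_top_axis_linear:
  assumes lower: "\<And>s I y. s > 0 \<Longrightarrow> I \<noteq> UNIV \<Longrightarrow> H s I y = 0"
    and bdd: "\<And>s. s > 0 \<Longrightarrow> H s UNIV (axis i t) \<ge> - C" and s: "s > 0"
  shows "H s UNIV (axis i t) = s * H 1 UNIV (axis i t)" "H s UNIV (axis i t) \<ge> 0"
proof -
  obtain a where a: "a \<noteq> i" using other_index by blast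
  obtain b where b: "b \<noteq> i" "b \<noteq> a" using other_index by blast
  have 0: "axis i t $ a = 0" "axis i t $ b = 0" using a b by (auto simp: axis_def)
  have v: "vupd (axis i t) a 0 = axis i t" "vupd (axis i t) b 0 = axis i t"
    using vupd_same[of "axis i t" a] vupd_same[of "axis i t" b] 0 by simp_all
  have add: "H (p + q) UNIV (axis i t) = H p UNIV (axis i t) + H q UNIV (axis i t)" if "p > 0" "q > 0" for p q
  proof -
    define l where "l = p / (p + q)"
    have l: "0 < l" "l < 1" "l * (p + q) = p" "(1 - l) * (p + q) = q"
      using that by (auto simp: l_def field_simps)
    have "UNIV - {b} \<noteq> UNIV" by auto
    then show ?thesis
      using H_valuation[of "p + q" a UNIV b l 0 "axis i t"] b that l by (simp add: 0 v lower)
  qed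
  show "H s UNIV (axis i t) = s * H 1 UNIV (axis i t)" "H s UNIV (axis i t) \<ge> 0"
    using additive_bounded_below_linear[of "\<lambda>s. H s UNIV (axis i t)" C s, OF add bdd s] by auto
qed

text \<open>A 3-cycle through a third index is even; a transposition would reverse orientation, and
  in full dimension no free row can undo that.\<close>

lemma H_top_axis_permute:
  assumes "s > 0"
  shows "H s UNIV (axis i t) = H s UNIV (axis j t)"
proof (cases "i = j")
  case False
  obtain k where k: "k \<noteq> i" "k \<noteq> j" using other_index by blast
  let ?p = "Transposition.transpose i k \<circ> Transposition.transpose i j"
  have p: "?p permutes UNIV" by (intro permutes_compose permutes_swap_id) auto
  have "sign ?p = 1"
    using False k by (simp add: sign_compose permutation_swap_id sign_swap_id)
  moreover have "?p ` UNIV = UNIV" using permutes_image[OF p] .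
  moreover have "?p i = j" using False k by (simp add: Transposition.transpose_def)
  ultimately show ?thesis using H_permute[OF assms p, of UNIV i t] by simp
qed simp

text \<open>Uniqueness: a functional is determined by its values at plus and minus a unit vector on
  a segment, on a triangle, and on full simplices of every volume.\<close>

lemma h_eq_zero:
  fixes i0 j0 :: 'n
  assumes ij0: "i0 \<noteq> j0"
    and one: "H 1 {i0} (axis i0 1) = 0" "H 1 {i0} (axis i0 (-1)) = 0"
    and two: "H 1 {i0, j0} (axis i0 1) = 0" "H 1 {i0, j0} (axis i0 (-1)) = 0"
    and top: "\<And>s. s > 0 \<Longrightarrow> H s UNIV (axis i0 1) = 0" "\<And>s. s > 0 \<Longrightarrow> H s UNIV (axis i0 (-1)) = 0"
    and T: "T \<in> origin_simplices"
  shows "h T x = 0"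
proof -
  have lower: "H s I y = 0" if "s > 0" "I \<noteq> UNIV" for s I y
    by (rule H_lower_zero[OF ij0 one two that(2,1)])
  have "H s UNIV y = 0" if "s > 0" for s y
  proof (rule functional_equation_unique[of "\<lambda>s. H s UNIV" UNIV])
    show "H s UNIV y = H (l * s) UNIV (vupd y j w) + H ((1 - l) * s) UNIV (vupd y i w)"
      if "s > 0" "i \<in> UNIV" "j \<in> UNIV" "i \<noteq> j" "0 < l" "l < 1" "w = (1 - l) * y $ i + l * y $ j" for s y i j l w
    proof -
      have "UNIV - {j} \<noteq> UNIV" "(1 - l) * s > 0" using that by auto
      from H_valuation[OF that] lower[OF this(2,1)] show ?thesis by simp
    qed
    show "H s UNIV (axis i t) = 0" if "s > 0" for s i t
      using H_axis[OF that top(1)[OF that] top(2)[OF that], of t] H_top_axis_permute[OF that, of i t i0] by simp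
  qed (use that continuous_on_H H_zero in auto)
  then have H0: "H s I y = 0" if "s > 0" for s I y using lower that by (cases "I = UNIV") auto
  obtain A I where A: "det A > 0" "T = row_simplex I A"
    by (rule origin_simplex_as_row_simplex[OF card3 T])
  show ?thesis unfolding A(2) h_row_simplex[OF refl A(1)] by (rule H0[OF A(1)])
qed

end

lemma SL_valuation_diff:
  fixes h g :: "(real^'n) set \<Rightarrow> real^'n \<Rightarrow> real"
  assumes "SL_valuation h" "SL_valuation g"
  shows "SL_valuation (\<lambda>T x. h T x - c * g T x)"
proof -
  interpret h: SL_valuation h by fact
  interpret g: SL_valuation g by fact
  show ?thesis
  proof
    show "CARD('n) \<ge> 3" by (rule h.card3)
  next
    fix K L :: "(real^'n) set" and x
    assume "K \<in> origin_simplices" "L \<in> origin_simplices" "K \<union> L \<in> origin_simplices" "K \<inter> L \<in> origin_simplices"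
    from h.valuation[OF this, of x] g.valuation[OF this, of x]
    have "h (K \<union> L) x = h K x + h L x - h (K \<inter> L) x" "g (K \<union> L) x = g K x + g L x - g (K \<inter> L) x" by auto
    then show "h (K \<union> L) x - c * g (K \<union> L) x + (h (K \<inter> L) x - c * g (K \<inter> L) x)
      = h K x - c * g K x + (h L x - c * g L x)" by (simp only: right_diff_distrib distrib_left)
  next
    fix T :: "(real^'n) set" assume "T \<in> origin_simplices"
    then show "continuous_on UNIV (\<lambda>x. h T x - c * g T x)"
      by (intro continuous_intros h.continuous g.continuous)
  next
    fix T :: "(real^'n) set" and d :: real and x assume "T \<in> origin_simplices" "d \<ge> 0"
    then show "h T (d *\<^sub>R x) - c * g T (d *\<^sub>R x) = d * (h T x - c * g T x)"
      by (simp add: h.homogeneous g.homogeneous algebra_simps)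
  next
    fix Q :: "real^'n^'n" and T :: "(real^'n) set" and x
    assume "det Q = 1" "T \<in> origin_simplices"
    then show "h ((*v) Q ` T) x - c * g ((*v) Q ` T) x = h T (transpose Q *v x) - c * g T (transpose Q *v x)"
      using h.covariant g.covariant by presburger
  qed
qed

section \<open>The valuations in the representation\<close>

lemma SL_valuation_support_fun:
  fixes Z :: "(real^'n) set \<Rightarrow> (real^'n) set"
  assumes card3: "CARD('n) \<ge> 3"
    and Z: "\<forall>T \<in> origin_simplices. Z T \<in> convex_bodies_o"
    and val: "minkowski_valuation_on origin_simplices Z"
    and cov: "SL_covariant_on origin_simplices Z"
  shows "SL_valuation (\<lambda>T. support_fun (Z T))"
proof
  have b: "compact (Z T)" "Z T \<noteq> {}" if "T \<in> origin_simplices" for T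
    using Z that by (auto simp: convex_bodies_o_def)
  show "CARD('n) \<ge> 3" by fact
  show "support_fun (Z ((*v) Q ` T)) x = support_fun (Z T) (transpose Q *v x)"
    if "det Q = 1" "T \<in> origin_simplices" for Q T x
  proof -
    have "Z ((*v) Q ` T) = (*v) Q ` Z T" using cov that by (simp add: SL_covariant_on_def)
    then show ?thesis by (simp only: support_fun_matrix_image)
  qed
  show "support_fun (Z (K \<union> L)) x + support_fun (Z (K \<inter> L)) x = support_fun (Z K) x + support_fun (Z L) x"
    if "K \<in> origin_simplices" "L \<in> origin_simplices" "K \<union> L \<in> origin_simplices" "K \<inter> L \<in> origin_simplices" for K L x
  proof -
    have "Z (K \<union> L) \<oplus>\<^sub>M Z (K \<inter> L) = Z K \<oplus>\<^sub>M Z L"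
      using val that by (simp add: minkowski_valuation_on_def)
    then show ?thesis using that b support_fun_sum by metis
  qed
  show "continuous_on UNIV (support_fun (Z T))" if "T \<in> origin_simplices" for T
    using continuous_on_support_fun b[OF that] by blast
  show "support_fun (Z T) (c *\<^sub>R x) = c * support_fun (Z T) x" if "T \<in> origin_simplices" "c \<ge> 0" for T c x
    using support_fun_homogeneous b[OF that(1)] that(2) by blast
qed

lemma SL_valuation_D_fun:
  assumes "CARD('n) \<ge> 3"
  shows "SL_valuation (D_fun a1 a2 b1 b2 :: (real^'n) set \<Rightarrow> _)"
proof
  show "D_fun a1 a2 b1 b2 ((*v) Q ` T) x = D_fun a1 a2 b1 b2 T (transpose Q *v x)"
    if "det Q = 1" for Q T and x :: "real^'n"
    by (rule D_fun_matrix_image) (simp add: that)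
qed (use assms D_fun_valuation continuous_on_D_fun D_fun_homogeneous in auto)

lemma SL_valuation_moment_fun:
  assumes "CARD('n) \<ge> 3"
  shows "SL_valuation (moment_fun :: (real^'n) set \<Rightarrow> _)"
proof
  show "CARD('n) \<ge> 3" by fact
  show "moment_fun ((*v) Q ` T) x = moment_fun T (transpose Q *v x)"
    if "det Q = 1" "T \<in> origin_simplices" for Q T and x :: "real^'n"
    using moment_fun_matrix_image[OF origin_simplexD(1)[OF that(2)], of Q x] that(1) by simp
  show "moment_fun (K \<union> L) x + moment_fun (K \<inter> L) x = moment_fun K x + moment_fun L x"
    if "K \<in> origin_simplices" "L \<in> origin_simplices" "K \<union> L \<in> origin_simplices" "K \<inter> L \<in> origin_simplices"
    for K L and x :: "real^'n"
    using moment_fun_valuation that origin_simplexD(1) by blast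
  fix T :: "(real^'n) set" assume T: "T \<in> origin_simplices"
  note B = moment_plus_body[OF origin_simplexD(1)[OF T]]
  have eq: "moment_fun T = support_fun (moment_plus T)" using B(4) by auto
  show "continuous_on UNIV (moment_fun T)"
    unfolding eq by (rule continuous_on_support_fun[OF B(1,3)])
  show "moment_fun T (c *\<^sub>R x) = c * moment_fun T x" if "c \<ge> 0" for c x
    unfolding eq by (rule support_fun_homogeneous[OF B(1,3) that])
qed

lemma SL_valuation_reflect:
  fixes h :: "(real^'n) set \<Rightarrow> real^'n \<Rightarrow> real"
  assumes "SL_valuation h"
  shows "SL_valuation (\<lambda>T x. h T (- x))"
proof -
  interpret SL_valuation h by fact
  show ?thesis
  proof
    show "CARD('n) \<ge> 3" by (rule card3)
    show "h ((*v) Q ` T) (- x) = h T (- (transpose Q *v x))" if "det Q = 1" "T \<in> origin_simplices" for Q T x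
    proof -
      have "transpose Q *v (- x) = - (transpose Q *v x)" by (rule vec.neg)
      then show ?thesis using covariant[OF that, of "- x"] by simp
    qed
    show "h (K \<union> L) (- x) + h (K \<inter> L) (- x) = h K (- x) + h L (- x)"
      if "K \<in> origin_simplices" "L \<in> origin_simplices" "K \<union> L \<in> origin_simplices" "K \<inter> L \<in> origin_simplices"
      for K L and x by (rule valuation[OF that])
    show "continuous_on UNIV (\<lambda>x. h T (- x))" if "T \<in> origin_simplices" for T
      by (rule continuous_on_compose2[OF continuous[OF that]]) (auto intro: continuous_intros)
    show "h T (- (c *\<^sub>R x)) = c * h T (- x)" if "T \<in> origin_simplices" "c \<ge> 0" for T c x
      using homogeneous[OF that, of "- x"] by simp
  qed
qed

lemma D_fun_row_simplex:
  assumes A: "det A \<noteq> 0" and y: "y = A *v x" and ij: "i \<in> I" "j \<in> I"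
    and bd: "\<And>k. k \<in> I \<Longrightarrow> y $ j \<le> y $ k \<and> y $ k \<le> y $ i"
  shows "D_fun a1 a2 b1 b2 (row_simplex I A) x = D_form a1 a2 b1 b2 (y $ i) (y $ j)"
proof -
  have yk: "x \<bullet> A $ k = y $ k" for k by (simp add: y matrix_vector_mult_nth inner_commute)
  have "Max ((\<bullet>) x ` (\<lambda>k. A $ k) ` I) = y $ i"
    by (rule Max_eqI) (use ij bd yk in \<open>auto simp: image_iff\<close>)
  then have M: "support_fun (convex hull ((\<lambda>k. A $ k) ` I)) x = y $ i"
    using ij by (subst support_fun_convex_hull_finite) auto
  have "Max ((\<bullet>) (- x) ` (\<lambda>k. A $ k) ` I) = - y $ j"
    by (rule Max_eqI) (use ij bd yk in \<open>auto simp: image_iff\<close>)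
  then have m: "support_fun (convex hull ((\<lambda>k. A $ k) ` I)) (- x) = - y $ j"
    using ij by (subst support_fun_convex_hull_finite) auto
  have "convex hull ((\<lambda>k. A $ k) ` I) \<noteq> {}" using ij by auto
  then show ?thesis by (simp add: D_fun_def outer_face_row_simplex[OF A] M m)
qed

lemma compact_std_face: "compact (std_face I)"
  unfolding std_face_hull by (rule finite_imp_compact_convex_hull) simp

lemma moment_fun_row_simplex:
  assumes "det A > 0"
  shows "moment_fun (row_simplex I A) x = det A * moment_fun (std_face I) (A *v x)"
proof -
  have "row_simplex I A = (*v) (transpose A) ` std_face I" by (simp add: row_simplex_def)
  then show ?thesis
    using moment_fun_matrix_image[OF compact_std_face, of "transpose A" I x] assms
    by (simp add: det_transpose del: transpose_matrix_vector)
qed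

text \<open>Positivity allows division by this number when \<open>c1\<close> and \<open>c2\<close>
  are defined. The cube with sides from \<open>1 / (2 * n)\<close> to \<open>1 / n\<close> lies in
  the simplex, and the integrand is at least \<open>1 / (2 * n)\<close> on it.\<close>

lemma moment_fun_std_face_pos:
  "moment_fun (std_face UNIV) (axis (i::'n::finite) 1) > 0"
proof -
  define n where "n = real CARD('n)"
  have n: "n > 0" by (simp add: n_def)
  define c :: "real^'n" where "c = (\<chi> k. 1 / (2 * n))"
  define d :: "real^'n" where "d = (\<chi> k. 1 / n)"
  have sub: "cbox c d \<subseteq> std_face UNIV"
  proof
    fix u assume "u \<in> cbox c d"
    then have u: "1 / (2 * n) \<le> u $ k" "u $ k \<le> 1 / n" for k by (auto simp: mem_box_cart c_def d_def)
    have "(\<Sum>k\<in>UNIV. u $ k) \<le> (\<Sum>k\<in>(UNIV::'n set). 1 / n)" by (rule sum_mono) (rule u)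
    also have "\<dots> = 1" using n by (simp add: n_def)
    finally show "u \<in> std_face UNIV"
      using u(1) n by (auto simp: std_face_def intro: order_trans[OF _ u(1)])
  qed
  have "0 < measure lborel (cbox c d) * (1 / (2 * n))"
  proof -
    have "cbox c d \<noteq> {}" using n by (simp add: interval_ne_empty_cart c_def d_def field_simps)
    then have "measure lborel (cbox c d) = (\<Prod>k\<in>(UNIV::'n set). 1 / n - 1 / (2 * n))"
      by (simp add: content_cbox_cart c_def d_def)
    also have "\<dots> > 0" using n by (intro prod_pos) (simp add: field_simps)
    finally show ?thesis using n by simp
  qed
  also have "measure lborel (cbox c d) * (1 / (2 * n)) = (LINT y|lborel. indicator (cbox c d) y * (1 / (2 * n)))"
    by simp
  also have "\<dots> \<le> moment_fun (std_face UNIV) (axis i 1)"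
    unfolding moment_fun_def
  proof (rule integral_mono)
    show "integrable lborel (\<lambda>y. indicator (cbox c d) y * (1 / (2 * n)))"
      by (intro integrable_mult_left integrable_real_indicator) (use emeasure_lborel_cbox_finite[of c d] in \<open>auto simp: less_top\<close>)
    show "integrable lborel (\<lambda>y. indicator (std_face UNIV) y * max (axis i 1 \<bullet> y) 0)"
      by (rule integrable_moment[OF compact_std_face])
    fix y :: "real^'n"
    show "indicator (cbox c d) y * (1 / (2 * n)) \<le> indicator (std_face UNIV) y * max (axis i 1 \<bullet> y) 0"
    proof (cases "y \<in> cbox c d")
      case True
      then have "y \<in> std_face UNIV" "1 / (2 * n) \<le> y $ i" using sub by (auto simp: mem_box_cart c_def)
      then show ?thesis using True by (simp add: inner_axis')
    qed (simp add: indicator_def)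
  qed
  finally show ?thesis .
qed

text \<open>Together with reflection this decouples the two coefficients: the plus moment body is
  seen only at \<open>axis i 1\<close>, the minus moment body only at
  \<open>axis i (-1)\<close>.\<close>

lemma moment_fun_std_face_neg:
  "moment_fun (std_face I) (axis i (-1)) = 0"
proof -
  have "indicator (std_face I) y * max (axis i (-1) \<bullet> y) 0 = (0::real)" for y
    by (auto simp: indicator_def inner_axis' std_face_def)
  then show ?thesis by (simp only: moment_fun_def Bochner_Integration.integral_zero)
qed

lemma minkowski_formula_body:
  fixes V :: "(real^'n) set"
  assumes V: "finite V" "independent V"
    and ab: "a1 \<ge> 0" "a2 \<ge> 0" "b1 \<ge> 0" "b2 \<ge> 0" "a1 \<le> a2" "b1 \<le> b2" "a2 - a1 \<le> b2" "b2 - b1 \<le> a2"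
    and c: "c1 \<ge> 0" "c2 \<ge> 0"
  defines "T \<equiv> convex hull (insert 0 V)"
  defines "R \<equiv> ((*\<^sub>R) c1 ` moment_plus T) \<oplus>\<^sub>M ((*\<^sub>R) c2 ` moment_minus T) \<oplus>\<^sub>M D_body a1 a2 b1 b2 V"
  shows "compact R" "convex R" "R \<noteq> {}"
    "support_fun R x = c1 * moment_fun T x + c2 * moment_fun T (- x) + D_fun a1 a2 b1 b2 T x"
proof -
  have "compact T" unfolding T_def using V(1) by (simp add: finite_imp_compact_convex_hull)
  note P = moment_plus_body[OF this] and M = moment_minus_body[OF this] and D = support_fun_D_body[OF V ab]
  have PM: "compact ((*\<^sub>R) c1 ` moment_plus T)" "compact ((*\<^sub>R) c2 ` moment_minus T)"
     "convex ((*\<^sub>R) c1 ` moment_plus T)" "convex ((*\<^sub>R) c2 ` moment_minus T)"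
     "(*\<^sub>R) c1 ` moment_plus T \<noteq> {}" "(*\<^sub>R) c2 ` moment_minus T \<noteq> {}"
    using P M by (auto intro: compact_scaling convex_scaling)
  note S = compact_minkowski_sum[OF PM(1,2)] convex_minkowski_sum[OF PM(3,4)] minkowski_sum_nonempty[OF PM(5,6)]
  show "compact R" unfolding R_def by (rule compact_minkowski_sum[OF S(1) D(1)])
  show "convex R" unfolding R_def by (rule convex_minkowski_sum[OF S(2) D(2)])
  show "R \<noteq> {}" unfolding R_def by (rule minkowski_sum_nonempty[OF S(3) D(3)])
  show "support_fun R x = c1 * moment_fun T x + c2 * moment_fun T (- x) + D_fun a1 a2 b1 b2 T x"
    unfolding R_def support_fun_sum[OF S(1) D(1) S(3) D(3)] support_fun_sum[OF PM(1,2,5,6)]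
      support_fun_scale[OF P(1,3) c(1)] support_fun_scale[OF M(1,3) c(2)] P(4) M(4) D(4)
    by (simp add: T_def)
qed

section \<open>The classification\<close>

lemma H_D_fun:
  fixes y :: "real^'n"
  assumes card3: "CARD('n) \<ge> 3" and "s > 0" "i \<in> I" "j \<in> I" "\<And>k. k \<in> I \<Longrightarrow> y $ j \<le> y $ k \<and> y $ k \<le> y $ i"
  shows "SL_valuation.H (D_fun a1 a2 b1 b2) s I y = D_form a1 a2 b1 b2 (y $ i) (y $ j)"
proof -
  interpret D: SL_valuation "D_fun a1 a2 b1 b2 :: (real^'n) set \<Rightarrow> _" by (rule SL_valuation_D_fun[OF card3])
  have det: "det (diag_mat s :: real^'n^'n) = s" by (rule det_diag_mat)
  then obtain x where x: "(diag_mat s :: real^'n^'n) *v x = y"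
    using solve_matrix[of "diag_mat s" y] \<open>s > 0\<close> by auto
  show ?thesis
    using D.h_row_simplex[OF det \<open>s > 0\<close>, of I x]
      D_fun_row_simplex[of "diag_mat s" y x i I j] det x assms by simp
qed

lemma H_moment_fun:
  fixes y :: "real^'n"
  assumes card3: "CARD('n) \<ge> 3" and "s > 0"
  shows "SL_valuation.H moment_fun s I y = s * moment_fun (std_face I) y"
proof -
  interpret M: SL_valuation "moment_fun :: (real^'n) set \<Rightarrow> _" by (rule SL_valuation_moment_fun[OF card3])
  have det: "det (diag_mat s :: real^'n^'n) = s" by (rule det_diag_mat)
  then obtain x where x: "(diag_mat s :: real^'n^'n) *v x = y"
    using solve_matrix[of "diag_mat s" y] \<open>s > 0\<close> by auto
  show ?thesis
    using M.h_row_simplex[OF det \<open>s > 0\<close>, of I x] moment_fun_row_simplex[of "diag_mat s" I x] det x assms by simp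
qed

text \<open>The functional is proportional to the volume \<open>s\<close> by
  \<open>H_moment_fun\<close>, yet independent of it by \<open>H_lower\<close>.\<close>

lemma moment_fun_std_face_lower:
  fixes y :: "real^'n"
  assumes card3: "CARD('n) \<ge> 3" and "k \<notin> I"
  shows "moment_fun (std_face I) y = 0"
proof -
  interpret M: SL_valuation "moment_fun :: (real^'n) set \<Rightarrow> _" by (rule SL_valuation_moment_fun[OF card3])
  show ?thesis
    using M.H_lower[of 1 2 k I y] H_moment_fun[OF card3, of 1 I y] H_moment_fun[OF card3, of 2 I y] assms by simp
qed

lemma minkowski_valuation_representation:
  fixes Z :: "(real^'n) set \<Rightarrow> (real^'n) set"
  assumes card3: "CARD('n) \<ge> 3"
    and Z: "\<forall>T \<in> origin_simplices. Z T \<in> convex_bodies_o"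
    and val: "minkowski_valuation_on origin_simplices Z"
    and cov: "SL_covariant_on origin_simplices Z"
  obtains a1 a2 b1 b2 c1 c2 :: real where
    "a1 \<ge> 0" "a2 \<ge> 0" "b1 \<ge> 0" "b2 \<ge> 0" "c1 \<ge> 0" "c2 \<ge> 0"
    "a1 \<le> a2" "b1 \<le> b2" "a2 - a1 \<le> b2" "b2 - b1 \<le> a2"
    "\<forall>T \<in> origin_simplices. \<forall>x. support_fun (Z T) x =
      c1 * moment_fun T x + c2 * moment_fun T (- x) + D_fun a1 a2 b1 b2 T x"
proof -
  define hZ where "hZ T = support_fun (Z T)" for T
  interpret Z: SL_valuation hZ
    using SL_valuation_support_fun[OF assms] by (simp add: hZ_def[abs_def])
  have body: "compact (Z T)" "0 \<in> Z T" "Z T \<noteq> {}" if "T \<in> origin_simplices" for T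
    using Z that by (auto simp: convex_bodies_o_def)
  have Z_nonneg: "Z.H s I y \<ge> 0" if "s > 0" for s I y
    unfolding Z.H_def hZ_def by (rule support_fun_nonneg; rule body; rule Z.diag_simplex[OF that])
  have Z_sub: "Z.H s I (y + y') \<le> Z.H s I y + Z.H s I y'" if "s > 0" for s I y y'
    unfolding Z.H_def hZ_def matrix_vector_right_distrib
    by (rule support_fun_subadditive; rule body; rule Z.diag_simplex[OF that])
  define i0 :: 'n where "i0 = undefined"
  obtain j0 where ij: "j0 \<noteq> i0" using Z.other_index by blast
  obtain k0 where k0: "k0 \<noteq> i0" "k0 \<noteq> j0" using Z.other_index by blast
  have two_ne: "k0 \<notin> {i0, j0}" "k0 \<notin> {i0}" using k0 by auto
  define a1 where "a1 = Z.H 1 {i0} (axis i0 1)"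
  define b1 where "b1 = Z.H 1 {i0} (axis i0 (-1))"
  define a2 where "a2 = Z.H 1 {i0, j0} (axis i0 1)"
  define b2 where "b2 = Z.H 1 {i0, j0} (axis i0 (-1))"
  have nonneg: "a1 \<ge> 0" "a2 \<ge> 0" "b1 \<ge> 0" "b2 \<ge> 0"
    unfolding a1_def a2_def b1_def b2_def by (simp_all add: Z_nonneg)
  interpret D: SL_valuation "D_fun a1 a2 b1 b2 :: (real^'n) set \<Rightarrow> _" by (rule SL_valuation_D_fun[OF card3])
  note D_H = H_D_fun[OF card3, of _ _ _ _ _ a1 a2 b1 b2]
  have D1: "D.H 1 {i0} (axis i0 1) = a1" "D.H 1 {i0} (axis i0 (-1)) = b1"
    using D_H[of 1 i0 "{i0}" i0 "axis i0 1"] D_H[of 1 i0 "{i0}" i0 "axis i0 (-1)"]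
    by (simp_all add: D_form_def)
  have Daxis: "D.H s I (axis i0 1) = a2" "D.H s I (axis i0 (-1)) = b2" if "s > 0" "i0 \<in> I" "j0 \<in> I" for s I
    using D_H[of s i0 I j0 "axis i0 1"] D_H[of s j0 I i0 "axis i0 (-1)"] that ij
    by (auto simp: D_form_def axis_def)
  \<comment> \<open>The factor 1 only matches the shape of \<open>SL_valuation_diff\<close>.\<close>
  define E where "E T x = hZ T x - 1 * D_fun a1 a2 b1 b2 T x" for T x
  interpret E: SL_valuation E
    unfolding E_def[abs_def] by (rule SL_valuation_diff) (unfold_locales)
  have EH: "E.H s I y = Z.H s I y - D.H s I y" for s I y
    by (simp add: E.H_def Z.H_def D.H_def E_def)
  have E1: "E.H 1 {i0} (axis i0 1) = 0" "E.H 1 {i0} (axis i0 (-1)) = 0"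
    "E.H 1 {i0, j0} (axis i0 1) = 0" "E.H 1 {i0, j0} (axis i0 (-1)) = 0"
    unfolding EH by (simp_all add: D1 Daxis flip: a1_def a2_def b1_def b2_def)
  have E_lower: "E.H s I y = 0" if "s > 0" "I \<noteq> UNIV" for s I y
    by (rule E.H_lower_zero[OF ij[symmetric] E1 that(2,1)])
  \<comment> \<open>The lower bound needed for linearity: \<open>Z\<close> contributes a nonnegative
    value because its bodies contain the origin, and the D part at these points does not depend on
    \<open>s\<close>.\<close>
  have bdd: "E.H s UNIV (axis i0 1) \<ge> - a2" "E.H s UNIV (axis i0 (-1)) \<ge> - b2" if "s > 0" for s
    unfolding EH using Z_nonneg[OF that] by (simp_all add: Daxis that)
  define p where "p = moment_fun (std_face UNIV) (axis i0 1)"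
  have p: "p > 0" unfolding p_def by (rule moment_fun_std_face_pos)
  \<comment> \<open>\<open>p\<close> is the value of the plus moment functional at
    \<open>axis i0 1\<close> per unit of \<open>s\<close>, and by reflection that of the minus one
    at \<open>axis i0 (-1)\<close>.\<close>
  define c1 where "c1 = E.H 1 UNIV (axis i0 1) / p"
  define c2 where "c2 = E.H 1 UNIV (axis i0 (-1)) / p"
  have Etop: "E.H s UNIV (axis i0 1) = s * (c1 * p)" "E.H s UNIV (axis i0 (-1)) = s * (c2 * p)" if "s > 0" for s
    using E.H_top_axis_linear(1)[OF E_lower bdd(1) that] E.H_top_axis_linear(1)[OF E_lower bdd(2) that] p
    by (simp_all add: c1_def c2_def)
  have c: "c1 \<ge> 0" "c2 \<ge> 0"
    using E.H_top_axis_linear(2)[OF E_lower bdd(1), of 1] E.H_top_axis_linear(2)[OF E_lower bdd(2), of 1] p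
    by (simp_all add: c1_def c2_def)
  interpret M: SL_valuation "moment_fun :: (real^'n) set \<Rightarrow> _" by (rule SL_valuation_moment_fun[OF card3])
  interpret N: SL_valuation "\<lambda>T (x::real^'n). moment_fun T (- x)"
    by (rule SL_valuation_reflect) unfold_locales
  have MH: "M.H s I y = s * moment_fun (std_face I) y" if "s > 0" for s I y
    by (rule H_moment_fun[OF card3 that])
  have NH: "N.H s I y = s * moment_fun (std_face I) (- y)" if "s > 0" for s I y
  proof -
    have neg: "A *v (- y) = - (A *v y)" for A :: "real^'n^'n" by (rule vec.neg)
    have "N.H s I y = M.H s I (- y)" unfolding N.H_def M.H_def neg ..
    then show ?thesis using MH[OF that] by simp
  qed
  define E2 where "E2 T x = E T x - c1 * moment_fun T x" for T x
  interpret E2: SL_valuation E2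
    unfolding E2_def[abs_def] by (rule SL_valuation_diff) (unfold_locales)
  define E3 where "E3 T x = E2 T x - c2 * moment_fun T (- x)" for T x
  interpret E3: SL_valuation E3
    unfolding E3_def[abs_def] by (rule SL_valuation_diff) (unfold_locales)
  have E3H: "E3.H s I y = E.H s I y - c1 * M.H s I y - c2 * N.H s I y" for s I y
    by (simp add: E3.H_def E.H_def M.H_def N.H_def E3_def E2_def)
  have neg_axis: "- axis i0 (1::real) = axis i0 (-1)" "- axis i0 (-1::real) = axis i0 1"
    by (simp_all add: vec_eq_iff axis_def)
  have lower0: "moment_fun (std_face {i0, j0}) y = 0" "moment_fun (std_face {i0}) y = 0" for y :: "real^'n"
    using moment_fun_std_face_lower[OF card3 two_ne(1)] moment_fun_std_face_lower[OF card3 two_ne(2)] by auto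
  have E3_zero: "E3 T x = 0" if "T \<in> origin_simplices" for T x
  proof (rule E3.h_eq_zero[OF ij[symmetric] _ _ _ _ _ _ that])
    show "E3.H s UNIV (axis i0 1) = 0" "E3.H s UNIV (axis i0 (-1)) = 0" if "s > 0" for s
      using that by (simp_all add: E3H Etop MH NH neg_axis p_def moment_fun_std_face_neg)
  qed (simp_all add: E3H E1 MH NH lower0)
  have formula: "support_fun (Z T) x = c1 * moment_fun T x + c2 * moment_fun T (- x) + D_fun a1 a2 b1 b2 T x"
    if "T \<in> origin_simplices" for T x
    using E3_zero[OF that, of x] by (simp add: E3_def E2_def E_def hZ_def)
  have ZH: "Z.H s I y = D.H s I y + s * (c1 * moment_fun (std_face I) y + c2 * moment_fun (std_face I) (- y))"
    if "s > 0" for s I y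
  proof -
    have "Z.H s I y = D.H s I y + c1 * M.H s I y + c2 * N.H s I y"
      unfolding Z.H_def D.H_def M.H_def N.H_def hZ_def
      using formula[OF Z.diag_simplex[OF that]] by simp
    then show ?thesis using that by (simp add: MH NH algebra_simps)
  qed
  have ZH2: "Z.H 1 {i0, j0} y = D.H 1 {i0, j0} y" for y by (simp add: ZH lower0)
  text \<open>Convexity on the two-dimensional face along the line through \<open>(-1, 1)\<close> and \<open>(1, 1)\<close>.\<close>
  have a2_b2: "a2 - a1 \<le> b2"
  proof -
    let ?y = "axis i0 (-1) + axis j0 1 :: real^'n" and ?z = "axis i0 1 + axis j0 1 :: real^'n"
    have "D.H 1 {i0, j0} (?y + ?z) \<le> D.H 1 {i0, j0} ?y + D.H 1 {i0, j0} ?z"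
      using Z_sub[OF zero_less_one, of "{i0, j0}" ?y ?z] unfolding ZH2 .
    moreover have "D.H 1 {i0, j0} (?y + ?z) = 2 * a2"
      by (subst D_H[of 1 j0 _ i0]) (use ij in \<open>auto simp: D_form_def axis_def\<close>)
    moreover have "D.H 1 {i0, j0} ?y = a2 + b2"
      by (subst D_H[of 1 j0 _ i0]) (use ij in \<open>auto simp: D_form_def axis_def\<close>)
    moreover have "D.H 1 {i0, j0} ?z = a1"
      by (subst D_H[of 1 j0 _ i0]) (use ij in \<open>auto simp: D_form_def axis_def\<close>)
    ultimately show ?thesis by simp
  qed
  have b2_a2: "b2 - b1 \<le> a2"
  proof -
    let ?y = "axis i0 1 + axis j0 (-1) :: real^'n" and ?z = "axis i0 (-1) + axis j0 (-1) :: real^'n"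
    have "D.H 1 {i0, j0} (?y + ?z) \<le> D.H 1 {i0, j0} ?y + D.H 1 {i0, j0} ?z"
      using Z_sub[OF zero_less_one, of "{i0, j0}" ?y ?z] unfolding ZH2 .
    moreover have "D.H 1 {i0, j0} (?y + ?z) = 2 * b2"
      by (subst D_H[of 1 i0 _ j0]) (use ij in \<open>auto simp: D_form_def axis_def\<close>)
    moreover have "D.H 1 {i0, j0} ?y = a2 + b2"
      by (subst D_H[of 1 i0 _ j0]) (use ij in \<open>auto simp: D_form_def axis_def\<close>)
    moreover have "D.H 1 {i0, j0} ?z = b1"
      by (subst D_H[of 1 i0 _ j0]) (use ij in \<open>auto simp: D_form_def axis_def\<close>)
    ultimately show ?thesis by simp
  qed
  text \<open>In full dimension the moment terms disappear as the volume \<open>s\<close> tends to 0, so the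
    \<open>D\<close> part alone is subadditive there; a third coordinate is what gives the remaining bounds.\<close>
  have top_sub: "D.H 1 UNIV (y + z) \<le> D.H 1 UNIV y + D.H 1 UNIV z"
    if Ds: "\<And>s v. s > 0 \<Longrightarrow> v \<in> {y, z, y + z} \<Longrightarrow> D.H s UNIV v = D.H 1 UNIV v" for y z
  proof (rule field_le_epsilon)
    fix e :: real assume e: "e > 0"
    define m where "m v = c1 * moment_fun (std_face UNIV) v + c2 * moment_fun (std_face UNIV) (- v)" for v :: "real^'n"
    have m: "m v \<ge> 0" for v using c by (simp add: m_def moment_fun_nonneg)
    \<comment> \<open>Small enough for the moment terms on the right to stay below \<open>e\<close>;
      the summand 1 keeps the denominator positive.\<close>
    define s where "s = e / (m y + m z + 1)"
    have s: "s > 0" using e m[of y] m[of z] by (simp add: s_def)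
    have "D.H 1 UNIV (y + z) \<le> D.H 1 UNIV (y + z) + s * m (y + z)" using s m by simp
    also have "\<dots> \<le> D.H 1 UNIV y + s * m y + (D.H 1 UNIV z + s * m z)"
      using Z_sub[OF s, of UNIV y z] Ds[OF s] unfolding ZH[OF s] m_def by simp
    also have "\<dots> = D.H 1 UNIV y + D.H 1 UNIV z + s * (m y + m z)" by (simp add: algebra_simps)
    also have "s * (m y + m z) \<le> s * (m y + m z + 1)" using s by simp
    also have "\<dots> = e" using m[of y] m[of z] by (simp add: s_def)
    finally show "D.H 1 UNIV (y + z) \<le> D.H 1 UNIV y + D.H 1 UNIV z + e" by simp
  qed
  have a: "a1 \<le> a2"
  proof -
    \<comment> \<open>Both points have maximum 1 and minimum 0, with value \<open>a2\<close>. Their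
      zeros sit at different indices, so the sum has minimum 1, while the index \<open>k0\<close>
      gives it maximum 2: its value is \<open>a2 + a1\<close>, and subadditivity yields
      \<open>a1 \<le> a2\<close>.\<close>
    define y :: "real^'n" where "y = (\<chi> k. if k = i0 then 0 else 1)"
    define z :: "real^'n" where "z = (\<chi> k. if k = j0 then 0 else 1)"
    have 1: "D.H s UNIV y = a2" if "s > 0" for s
      using D_H[of s k0 UNIV i0 y] that k0 by (simp add: y_def D_form_def)
    have 2: "D.H s UNIV z = a2" if "s > 0" for s
      using D_H[of s k0 UNIV j0 z] that k0 by (simp add: z_def D_form_def)
    have 3: "D.H s UNIV (y + z) = a2 + a1" if "s > 0" for s
      using D_H[of s k0 UNIV i0 "y + z"] that k0 ij by (simp add: y_def z_def D_form_def)
    have "D.H 1 UNIV (y + z) \<le> D.H 1 UNIV y + D.H 1 UNIV z"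
      by (rule top_sub) (use 1 2 3 in auto)
    then show ?thesis by (simp add: 1 2 3)
  qed
  have b: "b1 \<le> b2"
  proof -
    define y :: "real^'n" where "y = (\<chi> k. if k = i0 then 0 else -1)"
    define z :: "real^'n" where "z = (\<chi> k. if k = j0 then 0 else -1)"
    have 1: "D.H s UNIV y = b2" if "s > 0" for s
      using D_H[of s i0 UNIV k0 y] that k0 by (simp add: y_def D_form_def)
    have 2: "D.H s UNIV z = b2" if "s > 0" for s
      using D_H[of s j0 UNIV k0 z] that k0 by (simp add: z_def D_form_def)
    have 3: "D.H s UNIV (y + z) = b2 + b1" if "s > 0" for s
      using D_H[of s i0 UNIV k0 "y + z"] that k0 ij by (simp add: y_def z_def D_form_def)
    have "D.H 1 UNIV (y + z) \<le> D.H 1 UNIV y + D.H 1 UNIV z"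
      by (rule top_sub) (use 1 2 3 in auto)
    then show ?thesis by (simp add: 1 2 3)
  qed
  show ?thesis by (rule that[OF nonneg c a b a2_b2 b2_a2]) (use formula in blast)
qed

text \<open>The formula is itself an \<open>SL_valuation\<close>, and since all sets involved are
  nonempty compact convex, its identities lift to bodies by
  \<open>support_fun_inject\<close>.\<close>

lemma minkowski_valuation_if_support:
  fixes Z :: "(real^'n) set \<Rightarrow> (real^'n) set"
  assumes card3: "CARD('n) \<ge> 3"
    and Z: "\<forall>T \<in> origin_simplices. Z T \<in> convex_bodies_o"
    and supp: "\<And>T x. T \<in> origin_simplices \<Longrightarrow> support_fun (Z T) x =
      c1 * moment_fun T x + c2 * moment_fun T (- x) + D_fun a1 a2 b1 b2 T x"
  shows "minkowski_valuation_on origin_simplices Z \<and> SL_covariant_on origin_simplices Z"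
proof -
  note M = SL_valuation_moment_fun[OF card3]
  \<comment> \<open>Written with negated coefficients so that the sum is an instance of
    \<open>SL_valuation_diff\<close>.\<close>
  define g where "g T x = D_fun a1 a2 b1 b2 T x - (- c1) * moment_fun T x - (- c2) * moment_fun T (- x)"
    for T and x :: "real^'n"
  interpret g: SL_valuation g
    unfolding g_def[abs_def] by (intro SL_valuation_diff SL_valuation_D_fun card3 SL_valuation_reflect M)
  have sg: "support_fun (Z T) x = g T x" if "T \<in> origin_simplices" for T x
    using supp[OF that] by (simp add: g_def)
  have body: "compact (Z T)" "convex (Z T)" "Z T \<noteq> {}" if "T \<in> origin_simplices" for T
    using Z that by (auto simp: convex_bodies_o_def)
  have "Z (K \<union> L) \<oplus>\<^sub>M Z (K \<inter> L) = Z K \<oplus>\<^sub>M Z L"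
    if "K \<in> origin_simplices" "L \<in> origin_simplices" "K \<union> L \<in> origin_simplices" "K \<inter> L \<in> origin_simplices" for K L
    by (rule support_fun_inject)
       (use that body g.valuation[OF that] in
        \<open>simp_all add: compact_minkowski_sum convex_minkowski_sum minkowski_sum_nonempty support_fun_sum sg\<close>)
  moreover have "Z ((*v) Q ` T) = (*v) Q ` Z T" if Q: "det Q = 1" and T: "T \<in> origin_simplices" for Q T
  proof -
    obtain A I where A: "det A > 0" "T = row_simplex I A"
      using origin_simplex_as_row_simplex[OF card3 T] by blast
    have "(*v) Q ` T = row_simplex I (A ** transpose Q)"
      unfolding A(2) row_simplex_matrix_mult transpose_transpose ..
    then have QT: "(*v) Q ` T \<in> origin_simplices"
      using A Q by (simp add: row_simplex_in_origin_simplices det_mul det_transpose)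
    have "compact ((*v) Q ` Z T)"
      by (intro compact_continuous_image body T matrix_vector_mult_linear_continuous_on)
    moreover have "convex ((*v) Q ` Z T)"
      by (intro convex_linear_image body T) auto
    moreover have "support_fun (Z ((*v) Q ` T)) x = support_fun ((*v) Q ` Z T) x" for x
      unfolding support_fun_matrix_image sg[OF QT] sg[OF T] by (rule g.covariant[OF Q T])
    ultimately show ?thesis
      using body[OF QT] body[OF T] by (intro support_fun_inject) auto
  qed
  ultimately show ?thesis
    unfolding minkowski_valuation_on_def SL_covariant_on_def by blast
qed

theorem theorem5p11:
  fixes Z :: "(real^'n) set \<Rightarrow> (real^'n) set"
  assumes "CARD('n) \<ge> 3"
    and "\<forall>T \<in> origin_simplices. Z T \<in> convex_bodies_o"
  shows "(minkowski_valuation_on origin_simplices Z \<and> SL_covariant_on origin_simplices Z)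
    \<longleftrightarrow>
    (\<exists>a1 a2 b1 b2 c1 c2 :: real.
       a1 \<ge> 0 \<and> a2 \<ge> 0 \<and> b1 \<ge> 0 \<and> b2 \<ge> 0 \<and> c1 \<ge> 0 \<and> c2 \<ge> 0 \<and>
       a1 \<le> a2 \<and> b1 \<le> b2 \<and> a2 - a1 \<le> b2 \<and> b2 - b1 \<le> a2 \<and>
       (\<forall>V. finite V \<and> independent V \<longrightarrow>
          Z (convex hull (insert 0 V)) =
            ((*\<^sub>R) c1 ` moment_plus (convex hull (insert 0 V)))
            \<oplus>\<^sub>M ((*\<^sub>R) c2 ` moment_minus (convex hull (insert 0 V)))
            \<oplus>\<^sub>M D_body a1 a2 b1 b2 V))"
    (is "?L \<longleftrightarrow> (\<exists>a1 a2 b1 b2 c1 c2. ?R a1 a2 b1 b2 c1 c2)")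
proof
  assume ?L
  then obtain a1 a2 b1 b2 c1 c2 where
    ab1: "a1 \<ge> 0" "a2 \<ge> 0" "b1 \<ge> 0" "b2 \<ge> 0" and c: "c1 \<ge> 0" "c2 \<ge> 0"
    and ab2: "a1 \<le> a2" "b1 \<le> b2" "a2 - a1 \<le> b2" "b2 - b1 \<le> a2"
    and supp: "\<forall>T \<in> origin_simplices. \<forall>x. support_fun (Z T) x =
      c1 * moment_fun T x + c2 * moment_fun T (- x) + D_fun a1 a2 b1 b2 T x"
    by (elim conjE) (rule minkowski_valuation_representation[OF assms])
  note ab = ab1 ab2
  have eq: "Z (convex hull (insert 0 V)) = ((*\<^sub>R) c1 ` moment_plus (convex hull (insert 0 V)))
            \<oplus>\<^sub>M ((*\<^sub>R) c2 ` moment_minus (convex hull (insert 0 V)))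
            \<oplus>\<^sub>M D_body a1 a2 b1 b2 V" if V: "finite V" "independent V" for V
  proof -
    have T: "convex hull (insert 0 V) \<in> origin_simplices" using V by (auto simp: origin_simplices_def)
    then have Z: "compact (Z (convex hull (insert 0 V)))" "convex (Z (convex hull (insert 0 V)))"
      "Z (convex hull (insert 0 V)) \<noteq> {}"
      using assms(2) by (auto simp: convex_bodies_o_def)
    note F = minkowski_formula_body[OF V ab c]
    show ?thesis
      by (rule support_fun_inject[OF Z F(1-3)]) (simp only: F(4) supp[rule_format, OF T])
  qed
  have "?R a1 a2 b1 b2 c1 c2" by (intro conjI ab c allI impI, elim conjE, rule eq)
  then show "\<exists>a1 a2 b1 b2 c1 c2. ?R a1 a2 b1 b2 c1 c2" by (intro exI)
next
  assume "\<exists>a1 a2 b1 b2 c1 c2. ?R a1 a2 b1 b2 c1 c2"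
  then obtain a1 a2 b1 b2 c1 c2 where R: "?R a1 a2 b1 b2 c1 c2" by (elim exE)
  show ?L
  proof (rule minkowski_valuation_if_support[OF assms])
    fix T :: "(real^'n) set" and x assume "T \<in> origin_simplices"
    then obtain V where V: "finite V" "independent V" "T = convex hull (insert 0 V)"
      by (auto simp: origin_simplices_def)
    then have ZT: "Z T = ((*\<^sub>R) c1 ` moment_plus T) \<oplus>\<^sub>M ((*\<^sub>R) c2 ` moment_minus T) \<oplus>\<^sub>M D_body a1 a2 b1 b2 V"
      using R by blast
    show "support_fun (Z T) x = c1 * moment_fun T x + c2 * moment_fun T (- x) + D_fun a1 a2 b1 b2 T x"
      unfolding ZT unfolding V(3) by (rule minkowski_formula_body(4)[OF V(1,2)]) (use R in auto)
  qed
qed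

end
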